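(* Let $\phi\in L^\infty$ and let $\eta,\theta$ be two inner functions. Then: (i) the restricted Toeplitz operator $\mathcal{T}_\phi:\eta H^2\to K_\theta$ is of finite rank if and only if either $\phi\in\bar\eta\theta(H^\infty+\mathcal{R})$ or $\theta$ is a finite Blaschke product; (ii) the restricted Hankel operator $\mathcal{H}_\phi:\eta H^2\to K_\theta$ is of finite rank if and only if either $\phi\in\bar\eta(H^\infty+\mathcal{R})$ or $\theta$ is a finite Blaschke product.
   Context: $H^2$ is the Hardy space, viewed as a closed subspace of $L^2=L^2(\mathbb{T})$; $L^\infty=L^\infty(\mathbb{T})$; $H^\infty=L^\infty\cap H^2$. $\mathcal{R}$ is the set of rational functions $p(z)/q(z)$ such that all zeros of $q$ lie inside $\mathbb{D}$. For an inner function $\theta$, $K_\theta=H^2\ominus\theta H^2$ is the model space and $P_\theta:L^2\to K_\theta$ the orthogonal projection. The flip operator $\mathcal{J}:L^2\to L^2$ is $(\mathcal{J}f)(\xi)=\bar\xi f(\bar\xi)$, $\xi\in\mathbb{T}$. For $\phi\in L^\infty$ and inner functions $\eta,\theta$: $\mathcal{T}_\phi:\eta H^2\to K_\theta$, $\mathcal{T}_\phi(h)=P_\theta(\phi h)$, and $\mathcal{H}_\phi:\eta H^2\to K_\theta$, $\mathcal{H}_\phi(h)=P_\theta\mathcal{J}(\phi h)$. Unimodular constants count as finite Blaschke products (of degree $0$). *)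

theory Defs
  imports "HOL-Analysis.Analysis" "HOL-Computational_Algebra.Polynomial"
    "HOL-Library.Set_Algebras"
begin

text \<open>Normalized arc length on the unit circle, as a Borel measure on the complex plane
  concentrated on the circle.\<close>

definition circle_measure :: "complex measure" where
  "circle_measure = distr (uniform_measure lborel {-pi..pi}) borel cis"

lemma sets_circle_measure [simp, measurable_cong]: "sets circle_measure = sets borel"
  by (simp add: circle_measure_def)

lemma space_circle_measure [simp]: "space circle_measure = UNIV"
  by (simp add: circle_measure_def)

lemma borel_measurable_cnj [measurable]: "cnj \<in> borel_measurable borel"
  by (intro borel_measurable_continuous_onI continuous_intros)

lemma distr_circle_measure_cnj: "distr circle_measure borel cnj = circle_measure"
proof -
  let ?U = "uniform_measure lborel {-pi..pi::real}"
  have cis [measurable]: "cis \<in> borel_measurable borel"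
    by (intro borel_measurable_continuous_onI continuous_intros)
  have neg: "distr ?U borel uminus = ?U"
  proof (rule measure_eqI)
    fix A assume "A \<in> sets (distr ?U borel uminus)"
    then have A [measurable]: "A \<in> sets borel" by simp
    have m: "uminus -` A \<in> sets (borel :: real measure)"
      using measurable_sets[of "uminus :: real \<Rightarrow> real" borel borel A] A by simp
    have "emeasure lborel ({-pi..pi} \<inter> A) =
        emeasure (distr lborel borel uminus) ({-pi..pi} \<inter> A)"
      by (simp add: lborel_distr_uminus)
    also have "\<dots> = emeasure lborel (uminus -` ({-pi..pi} \<inter> A))"
      by (subst emeasure_distr) auto
    also have "uminus -` ({-pi..pi} \<inter> A) = {-pi..pi} \<inter> uminus -` A"
      by auto
    finally show "emeasure (distr ?U borel uminus) A = emeasure ?U A"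
      using m by (simp add: emeasure_distr)
  qed simp
  have "distr circle_measure borel cnj = distr ?U borel (\<lambda>t. cis (- t))"
    by (simp add: circle_measure_def distr_distr comp_def cis_cnj)
  also have "\<dots> = distr (distr ?U borel uminus) borel cis"
    by (subst distr_distr) (simp_all add: comp_def)
  finally show ?thesis
    by (simp add: neg circle_measure_def)
qed

lemma AE_circle_measure_cnj:
  assumes "AE x in circle_measure. P x"
  shows "AE x in circle_measure. P (cnj x)"
proof -
  have "cnj \<in> measurable circle_measure borel"
    by (simp add: measurable_cong_sets[OF sets_circle_measure refl]
        borel_measurable_continuous_onI continuous_on_cnj)
  moreover have "AE x in distr circle_measure borel cnj. P x"
    using assms by (subst distr_circle_measure_cnj)
  ultimately show ?thesis
    by (rule AE_distrD)
qed

definition circle_ae_eq :: "(complex \<Rightarrow> complex) \<Rightarrow> (complex \<Rightarrow> complex) \<Rightarrow> bool" where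
  "circle_ae_eq f g \<longleftrightarrow> f \<in> borel_measurable circle_measure \<and>
     g \<in> borel_measurable circle_measure \<and> (AE x in circle_measure. f x = g x)"

text \<open>Measurable functions on the circle modulo almost everywhere equality; \<open>L\<^sup>2\<close>,
  \<open>L\<^sup>\<infinity>\<close> and their subspaces are sets of elements of this type.\<close>

quotient_type circle_fun = "complex \<Rightarrow> complex" / partial: circle_ae_eq
proof (rule part_equivpI)
  show "\<exists>f. circle_ae_eq f f"
    by (rule exI[of _ "\<lambda>_. 0"]) (simp add: circle_ae_eq_def)
  show "symp circle_ae_eq"
    by (auto simp: symp_def circle_ae_eq_def elim: AE_mp)
  show "transp circle_ae_eq"
    unfolding transp_def circle_ae_eq_def
    by (auto elim: AE_mp)
qed

instantiation circle_fun :: comm_ring_1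
begin

lift_definition zero_circle_fun :: circle_fun is "\<lambda>_. 0"
  by (simp add: circle_ae_eq_def)

lift_definition one_circle_fun :: circle_fun is "\<lambda>_. 1"
  by (simp add: circle_ae_eq_def)

lift_definition plus_circle_fun :: "circle_fun \<Rightarrow> circle_fun \<Rightarrow> circle_fun"
  is "\<lambda>f g x. f x + g x"
  by (auto simp: circle_ae_eq_def)

lift_definition minus_circle_fun :: "circle_fun \<Rightarrow> circle_fun \<Rightarrow> circle_fun"
  is "\<lambda>f g x. f x - g x"
  by (auto simp: circle_ae_eq_def)

lift_definition uminus_circle_fun :: "circle_fun \<Rightarrow> circle_fun" is "\<lambda>f x. - f x"
  by (auto simp: circle_ae_eq_def)

lift_definition times_circle_fun :: "circle_fun \<Rightarrow> circle_fun \<Rightarrow> circle_fun"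
  is "\<lambda>f g x. f x * g x"
  by (auto simp: circle_ae_eq_def)

lemma circle_measure_not_null: "\<not> (AE x in circle_measure. False)"
proof -
  have [measurable]: "cis \<in> borel_measurable borel"
    by (intro borel_measurable_continuous_onI continuous_intros)
  have "emeasure circle_measure (space circle_measure) = 1"
    by (simp add: circle_measure_def emeasure_distr)
  then show ?thesis
    by (auto simp: AE_iff_null null_sets_def)
qed

instance
  by standard
    (transfer; auto simp: circle_ae_eq_def algebra_simps circle_measure_not_null)+

end

lift_definition cscale :: "complex \<Rightarrow> circle_fun \<Rightarrow> circle_fun" is "\<lambda>c f x. c * f x"
  by (auto simp: circle_ae_eq_def)

global_interpretation circle_fun: vector_space cscale
  by standard (transfer; auto simp: circle_ae_eq_def algebra_simps)+

lift_definition conj_fun :: "circle_fun \<Rightarrow> circle_fun" is "\<lambda>f x. cnj (f x)"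
  by (auto simp: circle_ae_eq_def)

lift_definition circle_integral :: "circle_fun \<Rightarrow> complex" is "\<lambda>f. LINT x|circle_measure. f x"
  by (auto simp: circle_ae_eq_def intro: integral_cong_AE)

lift_definition fourier_coeff :: "circle_fun \<Rightarrow> int \<Rightarrow> complex"
  is "\<lambda>f n. LINT x|circle_measure. f x * x powi (- n)"
  by (auto simp: circle_ae_eq_def power_int_def fun_eq_iff intro!: integral_cong_AE)

lift_definition square_integrable :: "circle_fun \<Rightarrow> bool"
  is "\<lambda>f. integrable circle_measure (\<lambda>x. (cmod (f x))\<^sup>2)"
  by (rule integrable_cong_AE) (auto simp: circle_ae_eq_def)

lift_definition essentially_bounded :: "circle_fun \<Rightarrow> bool"
  is "\<lambda>f. \<exists>C. AE x in circle_measure. cmod (f x) \<le> C"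
  by (rule ex_cong1) (auto simp: circle_ae_eq_def elim: AE_mp)

lift_definition unimodular :: "circle_fun \<Rightarrow> bool"
  is "\<lambda>f. AE x in circle_measure. cmod (f x) = 1"
  by (auto simp: circle_ae_eq_def elim: AE_mp)

definition L2 :: "circle_fun set" where
  "L2 = {f. square_integrable f}"

definition Linf :: "circle_fun set" where
  "Linf = {f. essentially_bounded f}"

definition H2 :: "circle_fun set" where
  "H2 = {f \<in> L2. \<forall>n<0. fourier_coeff f n = 0}"

definition Hinf :: "circle_fun set" where
  "Hinf = Linf \<inter> H2"

definition inner_function :: "circle_fun \<Rightarrow> bool" where
  "inner_function \<theta> \<longleftrightarrow> \<theta> \<in> Hinf \<and> unimodular \<theta>"

text \<open>The inner product of \<open>L\<^sup>2\<close>; only meaningful for arguments in \<open>L\<^sup>2\<close>.\<close>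

definition cinner :: "circle_fun \<Rightarrow> circle_fun \<Rightarrow> complex" where
  "cinner f g = circle_integral (f * conj_fun g)"

definition model_space :: "circle_fun \<Rightarrow> circle_fun set" where
  "model_space \<theta> = {f \<in> H2. \<forall>g \<in> (*) \<theta> ` H2. cinner f g = 0}"

text \<open>Orthogonal projection of \<open>L\<^sup>2\<close> onto a closed subspace.\<close>

definition orth_proj :: "circle_fun set \<Rightarrow> circle_fun \<Rightarrow> circle_fun" where
  "orth_proj K f = (THE g. g \<in> K \<and> (\<forall>k\<in>K. cinner (f - g) k = 0))"

lift_definition flip :: "circle_fun \<Rightarrow> circle_fun" is "\<lambda>f x. cnj x * f (cnj x)"
proof -
  fix f g assume fg: "circle_ae_eq f g"
  have *: "(\<lambda>x. cnj x * h (cnj x)) \<in> borel_measurable circle_measure"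
    if "h \<in> borel_measurable circle_measure" for h :: "complex \<Rightarrow> complex"
  proof -
    have [measurable]: "h \<in> borel_measurable borel"
      using that by (simp add: measurable_cong_sets[OF sets_circle_measure refl])
    show ?thesis by measurable
  qed
  have "AE x in circle_measure. f (cnj x) = g (cnj x)"
    using fg by (intro AE_circle_measure_cnj) (simp add: circle_ae_eq_def)
  then show "circle_ae_eq (\<lambda>x. cnj x * f (cnj x)) (\<lambda>x. cnj x * g (cnj x))"
    using fg * by (auto simp: circle_ae_eq_def)
qed

text \<open>The restricted operators send \<open>\<eta>H\<^sup>2\<close> to the model space of \<open>\<theta>\<close>. They are given
  here by total functions, and the domain is passed to \<open>finite_rank_on\<close>.\<close>

definition toeplitz_op :: "circle_fun \<Rightarrow> circle_fun \<Rightarrow> circle_fun \<Rightarrow> circle_fun" where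
  "toeplitz_op \<theta> \<phi> h = orth_proj (model_space \<theta>) (\<phi> * h)"

definition hankel_op :: "circle_fun \<Rightarrow> circle_fun \<Rightarrow> circle_fun \<Rightarrow> circle_fun" where
  "hankel_op \<theta> \<phi> h = orth_proj (model_space \<theta>) (flip (\<phi> * h))"

definition finite_rank_on :: "circle_fun set \<Rightarrow> (circle_fun \<Rightarrow> circle_fun) \<Rightarrow> bool" where
  "finite_rank_on S A \<longleftrightarrow> (\<exists>B. finite B \<and> circle_fun.span B = A ` S)"

text \<open>In the next two definitions \<^const>\<open>abs_circle_fun\<close> is applied to Borel functions only
  (division by zero gives zero, and the denominators do not vanish on the circle).\<close>

definition rational_funs :: "circle_fun set" where
  "rational_funs = {abs_circle_fun (\<lambda>z. poly p z / poly q z) | p q.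
     q \<noteq> 0 \<and> (\<forall>z. poly q z = 0 \<longrightarrow> cmod z < 1)}"

definition finite_blaschke :: "circle_fun \<Rightarrow> bool" where
  "finite_blaschke \<theta> \<longleftrightarrow> (\<exists>c as. cmod c = 1 \<and> (\<forall>a\<in>set as. cmod a < 1) \<and>
     \<theta> = abs_circle_fun (\<lambda>z. c * (\<Prod>a\<leftarrow>as. (z - a) / (1 - cnj a * z))))"

end

(*
  Write K for the model space and P for the projection onto it. Every f in L2 is k + u + theta v with k
  in K, u having only negative frequencies and v in H2, and then P f = k. Put psi = phi eta and
  A g = P (psi g) for g in H2; the claim is that A has finite rank iff conj(theta) psi is in Hinf + R
  or theta is a finite Blaschke product.

  Suppose that A has finite rank. If A g = 0 and psi g has a nonzero coefficient at -1 for some g, then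
  A (z g) is a nonzero multiple of P 1, and applying the shift repeatedly puts every P (z^n) in the
  range of A. By linear dependence P p = 0 for some polynomial p <> 0, so theta divides p in H2, and
  splitting off the roots of p one at a time exhibits theta as a finite Blaschke product. Otherwise ker A
  is shift invariant and contains a polynomial p <> 0, which forces p conj(theta) psi in H2; dividing by
  the roots of p (Kronecker) gives conj(theta) psi in Hinf + R. Division by z - a only needs the recursion
  of the Fourier coefficients, so no boundary value theory is used.

  The Hankel case follows from the Toeplitz one with symbol theta psi#, where f#(z) = conj(f(conj z)),
  because the flip is C (theta f#) for the conjugation C f = theta conj(z f), which commutes with P.
*)

theory Submission
  imports Defs "HOL-Probability.Probability_Measure"
    "HOL-Computational_Algebra.Fundamental_Theorem_Algebra"
begin

section \<open>Integration on the circle\<close>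

text \<open>The alternative comes from a rank one defect. If P f = 0, so that f = u + theta v, then
  multiplication by z moves just the coefficient of u at -1 to frequency 0, and P (z f) is that
  coefficient times P 1. Hence ker A can fail to be shift invariant only through the single vector P
  1, and the two cases are whether this happens. Finite rank enters as a linear dependence between
  vectors of the range; its coefficients are read as those of the polynomial p.

  The projection is a definite description on a type that also contains classes outside L2, so its
  existence has to be established. Two analytic facts carry this: Fourier coefficients determine an
  L2 function (Stone-Weierstrass, then a pi-lambda argument), and the nonnegative half of a Fourier
  series converges in L2 (completeness). From there on P is evaluated only by exhibiting a
  splitting.\<close>

interpretation circle: prob_space circle_measure
proof -
  have [measurable]: "cis \<in> borel_measurable borel"
    by (intro borel_measurable_continuous_onI continuous_intros)
  have "prob_space (uniform_measure lborel {-pi..pi})"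
    by (rule prob_space_uniform_measure) auto
  then show "prob_space circle_measure"
    unfolding circle_measure_def by (rule prob_space.prob_space_distr) simp
qed

lemma borel_measurable_cis [measurable]: "cis \<in> borel_measurable borel"
  by (intro borel_measurable_continuous_onI continuous_intros)

lemma borel_measurable_circle: "borel_measurable circle_measure = borel_measurable borel"
  by (rule measurable_cong_sets) simp_all

lemma AE_circle_norm: "AE x in circle_measure. cmod x = 1"
  unfolding circle_measure_def by (subst AE_distr_iff) auto

lemma AE_circle_nonzero: "AE x in circle_measure. x \<noteq> 0"
  using AE_circle_norm by eventually_elim auto

lemma AE_circle_cnj: "AE x in circle_measure. cnj x = inverse x"
  using AE_circle_norm proof eventually_elim
  case (elim x)
  then have "x * cnj x = 1" using complex_norm_square[of x] by simp
  then show ?case by (rule inverse_unique[symmetric])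
qed

lemma borel_measurable_powi [measurable]: "(\<lambda>x::complex. x powi n) \<in> borel_measurable borel"
  unfolding power_int_def by measurable

text \<open>For nonzero n the antiderivative of cis (n t) takes equal values at -pi and pi. This is
  what makes the powers \<open>zpow n\<close> orthonormal.\<close>

lemma circle_integral_powi:
  "(LINT x|circle_measure. x powi n) = (if n = 0 then 1 else 0)"
proof (cases "n = 0")
  case False
  \<comment> \<open>As a density the uniform measure gives an integral over \<open>lborel\<close>,
    where the fundamental theorem of calculus applies.\<close>
  have U: "uniform_measure lborel {-pi..pi} =
      density lborel (\<lambda>t. ennreal (indicator {-pi..pi} t / (2 * pi)))"
    unfolding uniform_measure_def
    by (intro arg_cong2[where f=density] refl ext)
      (auto simp: indicator_def divide_ennreal[symmetric] ennreal_1[symmetric] simp del: ennreal_1)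
  have "(LINT x|circle_measure. x powi n) = (LINT t|uniform_measure lborel {-pi..pi}. cis t powi n)"
    unfolding circle_measure_def by (rule integral_distr) auto
  also have "\<dots> = (LINT t|lborel. (indicator {-pi..pi} t / (2 * pi)) *\<^sub>R (cis t powi n))"
    unfolding U by (rule integral_density) auto
  also have "\<dots> = (LINT t|lborel. (1 / (2 * pi)) *\<^sub>R (indicator {-pi..pi} t *\<^sub>R cis (n * t)))"
    by (intro Bochner_Integration.integral_cong refl) (auto simp: cis_power_int mult.commute)
  also have "\<dots> = (1 / (2 * pi)) *\<^sub>R (LINT t|lborel. (indicator {-pi..pi} t *\<^sub>R cis (n * t)))"
    by (rule integral_scaleR_right)
  also have "(LINT t|lborel. (indicator {-pi..pi} t *\<^sub>R cis (n * t)))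
      = cis (n * pi) / (\<i> * n) - cis (n * (- pi)) / (\<i> * n)"
  proof (rule integral_FTC_Icc)
    show "((\<lambda>t. cis (n * t) / (\<i> * n)) has_vector_derivative cis (n * x)) (at x within {-pi..pi})" for x :: real
    proof -
      have "((\<lambda>z. exp (\<i> * (n * z)) / (\<i> * n)) has_field_derivative exp (\<i> * (n * complex_of_real x)))
          (at (of_real x))"
        using False by (auto intro!: derivative_eq_intros simp: mult.left_commute[of \<i>])
      from has_vector_derivative_real_field[OF this] show ?thesis
        by (simp add: cis_conv_exp has_vector_derivative_at_within)
    qed
  qed (auto intro!: continuous_intros)
  also have "cis (n * pi) / (\<i> * n) - cis (n * (- pi)) / (\<i> * n) = 0"
  proof -
    have "cis (n * pi) = cis (n * (- pi))"
      using sin_zero_iff_int2[of "n * pi"] by (simp add: complex_eq_iff)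
    then show ?thesis by simp
  qed
  finally show ?thesis using False by simp
qed (simp add: circle.prob_space[simplified])

text \<open>The class of integrable functions with vanishing Fourier coefficients is stable under
  multiplication by the coordinate functions, hence by real polynomials in them.\<close>

definition null_fourier :: "(complex \<Rightarrow> complex) \<Rightarrow> bool" where
  "null_fourier F \<longleftrightarrow> integrable circle_measure F \<and> (\<forall>n. (LINT x|circle_measure. F x * x powi n) = 0)"

lemma integrable_mult_bounded_circle:
  assumes "integrable circle_measure F" "g \<in> borel_measurable borel"
    "AE x in circle_measure. cmod (g x) \<le> C"
  shows "integrable circle_measure (\<lambda>x. F x * g x)"
proof (rule Bochner_Integration.integrable_bound)
  show "integrable circle_measure (\<lambda>x. C *\<^sub>R F x)" using assms by simp
  show "(\<lambda>x. F x * g x) \<in> borel_measurable circle_measure"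
    using borel_measurable_integrable[OF assms(1)] assms(2) by measurable
  show "AE x in circle_measure. norm (F x * g x) \<le> norm (C *\<^sub>R F x)"
    using assms(3)
  proof eventually_elim
    case (elim x)
    then have "norm (F x) * norm (g x) \<le> norm (F x) * \<bar>C\<bar>" by (intro mult_left_mono) auto
    then show ?case by (simp add: norm_mult mult.commute)
  qed
qed

lemma integrable_mult_powi:
  assumes "integrable circle_measure F"
  shows "integrable circle_measure (\<lambda>x. F x * x powi n)"
proof (rule integrable_mult_bounded_circle[OF assms, where C=1])
  show "AE x in circle_measure. cmod (x powi n) \<le> 1"
    using AE_circle_norm by eventually_elim (simp add: norm_power_int)
qed simp

lemma null_fourier_powi:
  assumes "null_fourier F"
  shows "null_fourier (\<lambda>x. F x * x powi k)"
  unfolding null_fourier_def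
proof safe
  show "integrable circle_measure (\<lambda>x. F x * x powi k)"
    using assms by (auto simp: null_fourier_def intro: integrable_mult_powi)
  fix n
  have "(LINT x|circle_measure. F x * x powi k * x powi n) = (LINT x|circle_measure. F x * x powi (k + n))"
  proof (rule integral_cong_AE)
    show "AE x in circle_measure. F x * x powi k * x powi n = F x * x powi (k + n)"
      using AE_circle_nonzero by eventually_elim (simp add: power_int_add mult.assoc)
  qed (use assms in \<open>auto simp: null_fourier_def dest!: borel_measurable_integrable\<close>)
  then show "(LINT x|circle_measure. F x * x powi k * x powi n) = 0"
    using assms by (simp add: null_fourier_def)
qed

lemma null_fourier_add:
  assumes "null_fourier F" "null_fourier G"
  shows "null_fourier (\<lambda>x. F x + G x)"
  using assms by (auto simp: null_fourier_def distrib_right integrable_mult_powi)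

lemma null_fourier_mult:
  assumes "null_fourier F"
  shows "null_fourier (\<lambda>x. F x * c)"
proof -
  have "(\<lambda>x. F x * c * x powi n) = (\<lambda>x. F x * x powi n * c)" for n
    by (simp add: ac_simps)
  then show ?thesis
    using assms by (simp add: null_fourier_def integrable_mult_powi)
qed

lemma null_fourier_cong:
  assumes "null_fourier F" "G \<in> borel_measurable borel" "AE x in circle_measure. F x = G x"
  shows "null_fourier G"
proof -
  have F: "F \<in> borel_measurable circle_measure" "integrable circle_measure F"
    using assms(1) by (auto simp: null_fourier_def)
  have G: "G \<in> borel_measurable circle_measure" using assms(2) by simp
  have "integrable circle_measure G"
    using F(2) G assms(3) by (rule integrable_cong_AE_imp)
  moreover have "(LINT x|circle_measure. G x * x powi n) = (LINT x|circle_measure. F x * x powi n)" for n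
    using F G assms(3) by (intro integral_cong_AE) auto
  ultimately show ?thesis using assms(1) by (auto simp: null_fourier_def)
qed

text \<open>On the circle a real linear functional is a combination of z and 1/z, both of which
  preserve the class. \<open>F\<close> stays arbitrary in the induction so that a product can be
  absorbed one factor at a time.\<close>

lemma null_fourier_real_polynomial:
  assumes "real_polynomial_function g" "null_fourier F"
  shows "null_fourier (\<lambda>x. F x * of_real (g x))"
  using assms
proof (induction g arbitrary: F rule: real_polynomial_function.induct)
  case (linear f)
  define a b where "a = complex_of_real (f 1)" and "b = complex_of_real (f \<i>)"
  have f: "of_real (f x) = a * Re x + b * Im x" for x
  proof -
    have "f x = f (Re x *\<^sub>R 1 + Im x *\<^sub>R \<i>)" 
      by (rule arg_cong[where f=f]) (simp add: complex_eq_iff)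
    also have "\<dots> = Re x * f 1 + Im x * f \<i>"
      using linear(1) by (simp add: bounded_linear.linear linear_add linear_scale)
    finally show ?thesis by (simp add: a_def b_def)
  qed
  have F [measurable]: "F \<in> borel_measurable circle_measure"
    using linear(2) by (auto simp: null_fourier_def)
  \<comment> \<open>The constants come from substituting Re x = (x + cnj x) / 2 and Im x = i (cnj x
    - x) / 2 into a Re x + b Im x and collecting x and cnj x = 1/x.\<close>
  have "null_fourier (\<lambda>x. F x * x powi 1 * ((a - \<i> * b) / 2) + F x * x powi (-1) * ((a + \<i> * b) / 2))"
    using linear(2) by (intro null_fourier_add null_fourier_mult null_fourier_powi)
  then show ?case
  proof (rule null_fourier_cong)
    have "continuous_on UNIV f" using linear(1) by (simp add: linear_continuous_on)
    then have [measurable]: "f \<in> borel_measurable borel"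
      by (rule borel_measurable_continuous_onI)
    have [measurable]: "F \<in> borel_measurable borel" using F by (simp add: borel_measurable_circle)
    show "(\<lambda>x. F x * complex_of_real (f x)) \<in> borel_measurable borel"
      by measurable
    show "AE x in circle_measure. F x * x powi 1 * ((a - \<i> * b) / 2) +
           F x * x powi - 1 * ((a + \<i> * b) / 2) = F x * complex_of_real (f x)"
      using AE_circle_cnj
    proof eventually_elim
      case (elim x)
      have x1: "x powi (-1) = cnj x" using elim by (simp add: power_int_minus)
      have x: "complex_of_real (Re x) = (x + cnj x) / 2" "complex_of_real (Im x) = \<i> * (cnj x - x) / 2"
        by (auto simp: complex_eq_iff)
      have "F x * complex_of_real (f x) = F x * (a * ((x + cnj x) / 2) + b * (\<i> * (cnj x - x) / 2))"
        unfolding f x ..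
      then show ?case unfolding x1 by (simp add: field_simps)
    qed
  qed
next
  case (const c)
  then show ?case by (rule null_fourier_mult)
next
  case (add f g)
  then show ?case by (simp add: distrib_left null_fourier_add)
next
  case (mult f g)
  from mult.IH(2)[OF mult.IH(1)[OF mult.prems]] show ?case by (simp add: mult.assoc)
qed

text \<open>Real polynomials approximate \<open>g\<close> uniformly on the unit circle, and the
  integral against \<open>F\<close> changes by at most the error times the integral of |F|.\<close>

lemma null_fourier_continuous:
  assumes F: "null_fourier F" and g: "continuous_on UNIV (g :: complex \<Rightarrow> real)"
  shows "(LINT x|circle_measure. F x * of_real (g x)) = 0"
proof (rule ccontr)
  let ?I = "LINT x|circle_measure. F x * of_real (g x)"
  let ?N = "LINT x|circle_measure. cmod (F x)"
  assume nz: "?I \<noteq> 0"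
  have int: "integrable circle_measure F" using F by (simp add: null_fourier_def)
  \<comment> \<open>With this error bound the integral would be smaller than its own modulus; the +
    1 keeps the quotient meaningful for \<open>?N\<close> = 0 and the inequality strict.\<close>
  define e where "e = cmod ?I / (?N + 1)"
  have N: "?N \<ge> 0" by simp
  have e: "e > 0" unfolding e_def using nz N by (intro divide_pos_pos) (auto intro: add_nonneg_pos)
  obtain p where p: "real_polynomial_function p" "\<And>x. x \<in> sphere 0 1 \<Longrightarrow> \<bar>g x - p x\<bar> < e"
    by (rule Stone_Weierstrass_real_polynomial_function[of "sphere 0 1" g e])
      (use e g in \<open>auto intro: continuous_on_subset\<close>)
  have [measurable]: "g \<in> borel_measurable borel" using g by (rule borel_measurable_continuous_onI)
  have "continuous_on UNIV p"
    using p(1) by (simp add: continuous_on_polymonial_function real_polynomial_function_eq)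
  then have [measurable]: "p \<in> borel_measurable borel" by (rule borel_measurable_continuous_onI)
  have nf: "null_fourier (\<lambda>x. F x * of_real (p x))"
    using p(1) F by (rule null_fourier_real_polynomial)
  then have Fp: "integrable circle_measure (\<lambda>x. F x * of_real (p x))"
    "(LINT x|circle_measure. F x * of_real (p x)) = 0"
    unfolding null_fourier_def using spec[of _ "0::int"] by (auto dest: spec[of _ "0::int"])
  have Fd: "integrable circle_measure (\<lambda>x. F x * of_real (g x - p x))"
  proof (rule integrable_mult_bounded_circle[OF int])
    show "AE x in circle_measure. cmod (complex_of_real (g x - p x)) \<le> e"
      using AE_circle_norm by eventually_elim (use p(2) in \<open>auto simp: less_imp_le simp del: of_real_diff\<close>)
  qed simp
  have "?I = (LINT x|circle_measure. F x * of_real (g x - p x) + F x * of_real (p x))"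
    by (simp add: algebra_simps)
  also have "\<dots> = (LINT x|circle_measure. F x * of_real (g x - p x))"
    using Fd Fp by (subst Bochner_Integration.integral_add) auto
  also have "cmod \<dots> \<le> (LINT x|circle_measure. cmod (F x * of_real (g x - p x)))"
    by (rule integral_norm_bound)
  also have "\<dots> \<le> (LINT x|circle_measure. e * cmod (F x))"
  proof (rule integral_mono_AE)
    show "AE x in circle_measure. cmod (F x * of_real (g x - p x)) \<le> e * cmod (F x)"
      using AE_circle_norm
    proof eventually_elim
      case (elim x)
      then have "\<bar>g x - p x\<bar> \<le> e" using p(2)[of x] by auto
      then show ?case using mult_right_mono[of "\<bar>g x - p x\<bar>" e "cmod (F x)"]
        by (simp add: norm_mult mult.commute del: of_real_diff)
    qed
  qed (use Fd int in auto)
  also have "\<dots> = e * ?N" by simp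
  also have "\<dots> < e * (?N + 1)" using e by simp
  also have "\<dots> = cmod ?I" using add_nonneg_pos[OF N zero_less_one] by (simp add: e_def)
  finally show False by simp
qed

text \<open>The continuous functions max 0 (1 - n dist(x, A)) converge pointwise to the indicator of
  the closed set and are bounded by 1, so dominated convergence applies.\<close>

lemma null_fourier_closed:
  assumes F: "null_fourier F" and A: "closed (A :: complex set)"
  shows "(LINT x:A|circle_measure. F x) = 0"
proof (cases "A = {}")
  \<comment> \<open>Treated apart because \<open>infdist\<close> to the empty set is 0, which would
    turn the approximating functions into the constant 1.\<close>
  case True
  then show ?thesis by (simp add: set_lebesgue_integral_def)
next
  case False
  have int: "integrable circle_measure F" using F by (simp add: null_fourier_def)
  then have [measurable]: "F \<in> borel_measurable borel" by (auto simp flip: borel_measurable_circle)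
  have [measurable]: "A \<in> sets borel" using A by simp
  define g where "g = (\<lambda>n x. max 0 (1 - real n * infdist x A))"
  have g: "continuous_on UNIV (g n)" for n
    unfolding g_def by (intro continuous_intros)
  have [measurable]: "g n \<in> borel_measurable borel" for n
    using g by (rule borel_measurable_continuous_onI)
  have "(\<lambda>n. LINT x|circle_measure. F x * of_real (g n x)) \<longlonglongrightarrow> (LINT x|circle_measure. indicator A x *\<^sub>R F x)"
  proof (rule integral_dominated_convergence[where w="\<lambda>x. cmod (F x)"])
    show "AE x in circle_measure. (\<lambda>n. F x * of_real (g n x)) \<longlonglongrightarrow> indicator A x *\<^sub>R F x"
    proof (rule AE_I2)
      fix x
      have "(\<lambda>n. g n x) \<longlonglongrightarrow> indicator A x"
      proof (cases "x \<in> A")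
        case True
        then show ?thesis by (simp add: g_def)
      next
        case nA: False
        then have pos: "infdist x A > 0" 
          using A False by (metis in_closed_iff_infdist_zero infdist_nonneg less_eq_real_def)
        have "eventually (\<lambda>n. real n \<ge> 1 / infdist x A) sequentially"
          using eventually_ge_at_top[of "nat \<lceil>1 / infdist x A\<rceil>"] by eventually_elim linarith
        then have "eventually (\<lambda>n. g n x = indicator A x) sequentially"
          by eventually_elim (use nA pos in \<open>simp add: g_def field_simps\<close>)
        then show ?thesis by (rule tendsto_eventually)
      qed
      then have "(\<lambda>n. F x * of_real (g n x)) \<longlonglongrightarrow> F x * of_real (indicator A x)"
        by (intro tendsto_intros)
      then show "(\<lambda>n. F x * of_real (g n x)) \<longlonglongrightarrow> indicator A x *\<^sub>R F x"
        by (simp add: scaleR_conv_of_real mult.commute)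
    qed
    show "AE x in circle_measure. norm (F x * of_real (g n x)) \<le> cmod (F x)" for n
      by (auto simp: norm_mult g_def infdist_nonneg intro!: mult_left_le)
  qed (use int in auto)
  moreover have "(LINT x|circle_measure. F x * of_real (g n x)) = 0" for n
    using F g by (rule null_fourier_continuous)
  ultimately show ?thesis by (simp add: set_lebesgue_integral_def LIMSEQ_const_iff)
qed

text \<open>Closed sets are stable under intersection and generate the Borel sets, so the integral
  of \<open>F\<close> vanishes over every Borel set; an integrable function with this property is
  zero almost everywhere.\<close>

lemma null_fourier_AE:
  assumes F: "null_fourier F"
  shows "AE x in circle_measure. F x = 0"
proof (rule circle.density_zero)
  show int: "integrable circle_measure F" using F by (simp add: null_fourier_def)
  fix A assume "A \<in> sets circle_measure"
  then have A: "A \<in> sigma_sets UNIV (Collect closed)"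
    by (simp add: borel_eq_closed)
  have "A \<in> sets circle_measure \<and> (LINT x:A|circle_measure. F x) = 0"
    using A
  proof (induction rule: sigma_sets_induct_disjoint[rotated 2, consumes 1, case_names basic empty compl union Int_stable Pow])
    case (basic A)
    then show ?case using null_fourier_closed[OF F] by auto
  next
    case empty
    then show ?case by (simp add: set_lebesgue_integral_def)
  next
    case (compl A)
    have all: "(LINT x:UNIV|circle_measure. F x) = 0"
      using null_fourier_closed[OF F] by auto
    have "(LINT x:UNIV|circle_measure. F x) = (LINT x:A \<union> (UNIV - A)|circle_measure. F x)" by simp
    also have "\<dots> = (LINT x:A|circle_measure. F x) + (LINT x:UNIV - A|circle_measure. F x)"
      using compl int by (intro set_integral_Un)
        (auto simp: set_integrable_def intro!: integrable_mult_indicator)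
    finally have "(LINT x:UNIV - A|circle_measure. F x) = 0" using compl(2) unfolding all by simp
    then show ?case using compl(2) by auto
  next
    case (union A)
    then show ?case using int
      by (subst lebesgue_integral_countable_add)
        (auto simp: set_integrable_def disjoint_family_on_def intro!: integrable_mult_indicator)
  qed (auto simp: Int_stable_def)
  then show "(LINT x:A|circle_measure. F x) = 0" by simp
qed

section \<open>Completeness for square integrals\<close>

text \<open>The Riesz-Fischer argument. The rate (1/4)^k makes the integrals of |F (k+1) - F k|
  summable, hence \<open>F\<close> converges almost everywhere; Fatou's lemma then passes the bound
  on F m - F k to the limit in m.\<close>

lemma square_complete:
  fixes F :: "nat \<Rightarrow> complex \<Rightarrow> complex"
  assumes meas [measurable]: "\<And>k. F k \<in> borel_measurable M"
    and M: "finite_measure M"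
    and Cauchy: "\<And>k m. k \<le> m \<Longrightarrow> (\<integral>\<^sup>+x. ennreal ((cmod (F m x - F k x))\<^sup>2) \<partial>M) \<le> ennreal ((1/4) ^ k)"
  obtains G where "G \<in> borel_measurable M"
    "\<And>k. (\<integral>\<^sup>+x. ennreal ((cmod (G x - F k x))\<^sup>2) \<partial>M) \<le> ennreal ((1/4) ^ k)"
proof -
  interpret finite_measure M by fact
  define c where "c = enn2real (emeasure M (space M))"
  have c: "emeasure M (space M) = ennreal c" "c \<ge> 0" by (auto simp: c_def emeasure_eq_measure)
  have D: "(\<integral>\<^sup>+x. ennreal (cmod (F (Suc k) x - F k x)) \<partial>M) \<le> ennreal ((1 + c) * (1/2) ^ k)" for k
  proof -
    have "(\<integral>\<^sup>+x. ennreal (cmod (F (Suc k) x - F k x)) \<partial>M)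
        \<le> (\<integral>\<^sup>+x. ennreal (2^k) * ennreal ((cmod (F (Suc k) x - F k x))\<^sup>2) + ennreal ((1/2)^k) \<partial>M)"
    proof (rule nn_integral_mono)
      fix x
      define d where "d = cmod (F (Suc k) x - F k x)"
      \<comment> \<open>A weighted inequality of means takes the place of Cauchy-Schwarz. The weight
        2^k balances the two terms: 2^k (1/4)^k is (1/2)^k.\<close>
      have "0 \<le> (2 ^ k * d - 1)\<^sup>2" by simp
      then have "2 * (2^k * d) \<le> (2^k * d)\<^sup>2 + 1" by (simp add: power2_diff)
      moreover have "0 \<le> 2^k * d" by (simp add: d_def)
      ultimately have "2^k * d \<le> (2^k * d)\<^sup>2 + 1" by linarith
      then have "d \<le> 2^k * d\<^sup>2 + (1/2)^k"
        by (simp add: field_simps power2_eq_square power_one_over)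
      then show "ennreal (cmod (F (Suc k) x - F k x))
          \<le> ennreal (2^k) * ennreal ((cmod (F (Suc k) x - F k x))\<^sup>2) + ennreal ((1/2)^k)"
        by (fold d_def) (simp add: d_def ennreal_leI flip: ennreal_mult ennreal_plus)
    qed
    also have "\<dots> = ennreal (2^k) * (\<integral>\<^sup>+x. ennreal ((cmod (F (Suc k) x - F k x))\<^sup>2) \<partial>M)
        + ennreal ((1/2)^k) * ennreal c"
      by (simp add: nn_integral_add nn_integral_cmult c)
    also have "\<dots> \<le> ennreal (2^k) * ennreal ((1/4)^k) + ennreal ((1/2)^k) * ennreal c"
      by (intro add_mono mult_left_mono Cauchy) auto
    also have "\<dots> = ennreal (2^k * (1/4)^k + (1/2)^k * c)"
      using c by (simp flip: ennreal_mult ennreal_plus)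
    also have "(2::real)^k * (1/4)^k = (1/2)^k"
      by (simp flip: power_mult_distrib)
    finally show ?thesis by (simp add: algebra_simps)
  qed
  have "(\<integral>\<^sup>+x. (\<Sum>k. ennreal (cmod (F (Suc k) x - F k x))) \<partial>M)
      = (\<Sum>k. \<integral>\<^sup>+x. ennreal (cmod (F (Suc k) x - F k x)) \<partial>M)"
    by (rule nn_integral_suminf) simp
  also have "\<dots> \<le> (\<Sum>k. ennreal ((1 + c) * (1/2) ^ k))"
    by (intro suminf_le D) auto
  also have "\<dots> = ennreal (\<Sum>k. (1 + c) * (1/2) ^ k)"
    using c by (intro suminf_ennreal2 summable_mult) auto
  finally have fin: "(\<integral>\<^sup>+x. (\<Sum>k. ennreal (cmod (F (Suc k) x - F k x))) \<partial>M) < \<infinity>"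
    by (simp add: le_less_trans)
  have "AE x in M. (\<Sum>k. ennreal (cmod (F (Suc k) x - F k x))) \<noteq> \<infinity>"
    by (rule nn_integral_PInf_AE) (use fin in auto)
  then have conv: "AE x in M. convergent (\<lambda>k. F k x)"
  proof eventually_elim
    case (elim x)
    then have "summable (\<lambda>k. cmod (F (Suc k) x - F k x))"
      by (intro summable_suminf_not_top) auto
    then have "summable (\<lambda>k. F (Suc k) x - F k x)"
      by (rule summable_norm_cancel)
    then have "convergent (\<lambda>n. \<Sum>k<n. F (Suc k) x - F k x)"
      by (simp add: summable_iff_convergent)
    then have "convergent (\<lambda>n. F n x - F 0 x)"
      by (simp add: sum_lessThan_telescope[where f="\<lambda>k. F k x"])
    then show ?case by (simp add: convergent_diff_const_right_iff)
  qed
  \<comment> \<open>Where the sequence diverges \<open>lim\<close> is an unspecified value, but this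
    concerns a null set only.\<close>
  define G where "G = (\<lambda>x. lim (\<lambda>k. F k x))"
  have [measurable]: "G \<in> borel_measurable M" unfolding G_def by measurable
  show ?thesis
  proof
    show "G \<in> borel_measurable M" by fact
    fix k
    have "(\<integral>\<^sup>+x. ennreal ((cmod (G x - F k x))\<^sup>2) \<partial>M)
        = (\<integral>\<^sup>+x. liminf (\<lambda>m. ennreal ((cmod (F m x - F k x))\<^sup>2)) \<partial>M)"
    proof (rule nn_integral_cong_AE)
      show "AE x in M. ennreal ((cmod (G x - F k x))\<^sup>2) = liminf (\<lambda>m. ennreal ((cmod (F m x - F k x))\<^sup>2))"
        using conv
      proof eventually_elim
        case (elim x)
        then have "(\<lambda>m. F m x) \<longlonglongrightarrow> G x" by (simp add: G_def convergent_LIMSEQ_iff)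
        then have "(\<lambda>m. ennreal ((cmod (F m x - F k x))\<^sup>2)) \<longlonglongrightarrow> ennreal ((cmod (G x - F k x))\<^sup>2)"
          by (intro tendsto_intros)
        then show ?case by (rule lim_imp_Liminf[OF trivial_limit_sequentially, symmetric])
      qed
    qed
    also have "\<dots> \<le> liminf (\<lambda>m. \<integral>\<^sup>+x. ennreal ((cmod (F m x - F k x))\<^sup>2) \<partial>M)"
      by (rule nn_integral_liminf) simp
    also have "\<dots> \<le> ennreal ((1/4)^k)"
      by (rule Liminf_le) (auto intro: eventually_mono[OF eventually_ge_at_top[of k] Cauchy])
    finally show "(\<integral>\<^sup>+x. ennreal ((cmod (G x - F k x))\<^sup>2) \<partial>M) \<le> ennreal ((1/4)^k)" .
  qed
qed

section \<open>The Hilbert space structure of \<open>L\<^sup>2\<close>\<close>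

lemma circle_ae_eq_refl [simp]: "circle_ae_eq F F \<longleftrightarrow> F \<in> borel_measurable borel"
  by (simp add: circle_ae_eq_def borel_measurable_circle)

text \<open>Gives access to a Borel representative where an argument concerns functions and their
  integrals rather than classes.\<close>

lemma circle_fun_abs_cases:
  obtains F where "F \<in> borel_measurable borel" "f = abs_circle_fun F"
proof -
  have "circle_ae_eq (rep_circle_fun f) (rep_circle_fun f)"
    by (rule Quotient3_rep_reflp[OF Quotient3_circle_fun])
  then show ?thesis
    using that[of "rep_circle_fun f"] Quotient3_abs_rep[OF Quotient3_circle_fun, of f] by simp
qed

lift_definition zpow :: "int \<Rightarrow> circle_fun" is "\<lambda>n x. x powi n"
  by simp

lift_definition polyf :: "complex poly \<Rightarrow> circle_fun" is "\<lambda>p x. poly p x"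
  by (auto intro!: borel_measurable_continuous_onI continuous_intros)

text \<open>Since inverse 0 = 0, this is total and multiplicative. It is a genuine reciprocal for
  polynomials without zeros on the circle, see \<open>polyf_invf\<close>.\<close>

lift_definition invf :: "circle_fun \<Rightarrow> circle_fun" is "\<lambda>f x. inverse (f x)"
  by (auto simp: circle_ae_eq_def)

lemma integrable_mult_square:
  fixes F G :: "complex \<Rightarrow> complex"
  assumes [measurable]: "F \<in> borel_measurable borel" "G \<in> borel_measurable borel"
    and int: "integrable circle_measure (\<lambda>x. (cmod (F x))\<^sup>2)" "integrable circle_measure (\<lambda>x. (cmod (G x))\<^sup>2)"
  shows "integrable circle_measure (\<lambda>x. F x * G x)"
proof (rule Bochner_Integration.integrable_bound)
  show "integrable circle_measure (\<lambda>x. (cmod (F x))\<^sup>2 + (cmod (G x))\<^sup>2)"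
    using int by simp
  have "cmod (F x * G x) \<le> (cmod (F x))\<^sup>2 + (cmod (G x))\<^sup>2" for x
  proof -
    have "0 \<le> cmod (F x) * cmod (G x)" by simp
    then show ?thesis
      using sum_squares_bound[of "cmod (F x)" "cmod (G x)"] unfolding norm_mult by linarith
  qed
  then show "AE x in circle_measure. cmod (F x * G x) \<le> norm ((cmod (F x))\<^sup>2 + (cmod (G x))\<^sup>2)"
    by simp
qed simp

lemma integrable_add_square:
  fixes F G :: "complex \<Rightarrow> complex"
  assumes [measurable]: "F \<in> borel_measurable borel" "G \<in> borel_measurable borel"
    and int: "integrable circle_measure (\<lambda>x. (cmod (F x))\<^sup>2)" "integrable circle_measure (\<lambda>x. (cmod (G x))\<^sup>2)"
  shows "integrable circle_measure (\<lambda>x. (cmod (F x + G x))\<^sup>2)"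
proof (rule Bochner_Integration.integrable_bound)
  show "integrable circle_measure (\<lambda>x. 2 * (cmod (F x))\<^sup>2 + 2 * (cmod (G x))\<^sup>2)"
    using int by simp
  have "(cmod (F x + G x))\<^sup>2 \<le> 2 * (cmod (F x))\<^sup>2 + 2 * (cmod (G x))\<^sup>2" for x
  proof -
    have "(cmod (F x + G x))\<^sup>2 \<le> (cmod (F x) + cmod (G x))\<^sup>2"
      by (intro power_mono norm_triangle_ineq) simp
    also have "\<dots> \<le> 2 * (cmod (F x))\<^sup>2 + 2 * (cmod (G x))\<^sup>2"
      using sum_squares_bound[of "cmod (F x)" "cmod (G x)"] by (simp add: power2_sum)
    finally show ?thesis .
  qed
  then show "AE x in circle_measure. norm ((cmod (F x + G x))\<^sup>2) \<le> norm (2 * (cmod (F x))\<^sup>2 + 2 * (cmod (G x))\<^sup>2)"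
    by simp
qed simp

lemma L2_add [intro]: "f \<in> L2 \<Longrightarrow> g \<in> L2 \<Longrightarrow> f + g \<in> L2"
  unfolding L2_def mem_Collect_eq
  by transfer (auto intro: integrable_add_square)

lemma L2_zero [intro, simp]: "0 \<in> L2"
  unfolding L2_def mem_Collect_eq by transfer simp

lemma L2_Linf_mult [intro]: "f \<in> Linf \<Longrightarrow> g \<in> L2 \<Longrightarrow> f * g \<in> L2"
  unfolding L2_def Linf_def mem_Collect_eq
proof transfer
  fix f g :: "complex \<Rightarrow> complex"
  assume "circle_ae_eq f f" "circle_ae_eq g g" and int: "integrable circle_measure (\<lambda>x. (cmod (g x))\<^sup>2)"
    and "\<exists>C. AE x in circle_measure. cmod (f x) \<le> C"
  then obtain C where [measurable]: "f \<in> borel_measurable borel" "g \<in> borel_measurable borel"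
    and C: "AE x in circle_measure. cmod (f x) \<le> C" by auto
  show "integrable circle_measure (\<lambda>x. (cmod (f x * g x))\<^sup>2)"
  proof (rule Bochner_Integration.integrable_bound)
    show "integrable circle_measure (\<lambda>x. C\<^sup>2 * (cmod (g x))\<^sup>2)" using int by simp
    show "AE x in circle_measure. norm ((cmod (f x * g x))\<^sup>2) \<le> norm (C\<^sup>2 * (cmod (g x))\<^sup>2)"
      using C
    proof eventually_elim
      case (elim x)
      then have "(cmod (f x))\<^sup>2 \<le> C\<^sup>2" by (intro power_mono) auto
      then have "(cmod (f x))\<^sup>2 * (cmod (g x))\<^sup>2 \<le> C\<^sup>2 * (cmod (g x))\<^sup>2" by (intro mult_right_mono) auto
      then show ?case by (simp add: norm_mult power_mult_distrib)
    qed
  qed simp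
qed

lemma Linf_mult [intro]: "f \<in> Linf \<Longrightarrow> g \<in> Linf \<Longrightarrow> f * g \<in> Linf"
  unfolding Linf_def mem_Collect_eq
proof transfer
  fix f g :: "complex \<Rightarrow> complex"
  assume "\<exists>C. AE x in circle_measure. cmod (f x) \<le> C" "\<exists>C. AE x in circle_measure. cmod (g x) \<le> C"
  then obtain C D where "AE x in circle_measure. cmod (f x) \<le> C" "AE x in circle_measure. cmod (g x) \<le> D"
    by auto
  then have "AE x in circle_measure. cmod (f x * g x) \<le> C * D"
  proof eventually_elim
    case (elim x)
    have "0 \<le> C" using norm_ge_zero[of "f x"] elim by linarith
    then show ?case using elim by (simp add: norm_mult mult_mono)
  qed
  then show "\<exists>C. AE x in circle_measure. cmod (f x * g x) \<le> C" ..
qed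

lemma Linf_add [intro]: "f \<in> Linf \<Longrightarrow> g \<in> Linf \<Longrightarrow> f + g \<in> Linf"
  unfolding Linf_def mem_Collect_eq
proof transfer
  fix f g :: "complex \<Rightarrow> complex"
  assume "\<exists>C. AE x in circle_measure. cmod (f x) \<le> C" "\<exists>C. AE x in circle_measure. cmod (g x) \<le> C"
  then obtain C D where "AE x in circle_measure. cmod (f x) \<le> C" "AE x in circle_measure. cmod (g x) \<le> D"
    by auto
  then have "AE x in circle_measure. cmod (f x + g x) \<le> C + D"
    by eventually_elim (auto intro: norm_triangle_le)
  then show "\<exists>C. AE x in circle_measure. cmod (f x + g x) \<le> C" ..
qed

lemma Linf_one [intro, simp]: "1 \<in> Linf"
  unfolding Linf_def mem_Collect_eq by transfer (auto intro: exI[of _ 1])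

lemma Linf_cscale [intro]: "f \<in> Linf \<Longrightarrow> cscale c f \<in> Linf"
  unfolding Linf_def mem_Collect_eq
proof transfer
  fix f :: "complex \<Rightarrow> complex" and c
  assume "\<exists>C. AE x in circle_measure. cmod (f x) \<le> C"
  then obtain C where "AE x in circle_measure. cmod (f x) \<le> C" by auto
  then have "AE x in circle_measure. cmod (c * f x) \<le> cmod c * C"
    by eventually_elim (simp add: norm_mult mult_left_mono)
  then show "\<exists>C. AE x in circle_measure. cmod (c * f x) \<le> C" ..
qed

lemma cscale_mult_left: "cscale c f * g = cscale c (f * g)"
  by transfer (auto simp: circle_ae_eq_def mult.assoc)

lemma cscale_mult_right: "f * cscale c g = cscale c (f * g)"
  by (metis cscale_mult_left mult.commute)

lemma uminus_eq_cscale: "- f = cscale (-1) f"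
  by transfer (auto simp: circle_ae_eq_def)

lemma L2_cscale [intro]: "f \<in> L2 \<Longrightarrow> cscale c f \<in> L2"
  using L2_Linf_mult[OF Linf_cscale[OF Linf_one], of f c] by (simp add: cscale_mult_left)

lemma L2_diff [intro]: "f \<in> L2 \<Longrightarrow> g \<in> L2 \<Longrightarrow> f - g \<in> L2"
  using L2_add[of f "- g"] L2_cscale[of g "-1"] by (simp flip: uminus_eq_cscale)

lemma Linf_diff [intro]: "f \<in> Linf \<Longrightarrow> g \<in> Linf \<Longrightarrow> f - g \<in> Linf"
  using Linf_add[of f "- g"] Linf_cscale[of g "-1"] by (simp flip: uminus_eq_cscale)

lemma Linf_conj [intro]: "f \<in> Linf \<Longrightarrow> conj_fun f \<in> Linf"
  unfolding Linf_def mem_Collect_eq by transfer simp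

lemma L2_conj [intro]: "f \<in> L2 \<Longrightarrow> conj_fun f \<in> L2"
  unfolding L2_def mem_Collect_eq by transfer simp

lemma L2_one [intro, simp]: "1 \<in> L2"
  unfolding L2_def mem_Collect_eq by transfer simp

lemma Linf_imp_L2: "f \<in> Linf \<Longrightarrow> f \<in> L2"
  using L2_Linf_mult[of f 1] by simp

lemma L2_sum [intro]: "(\<And>i. i \<in> A \<Longrightarrow> f i \<in> L2) \<Longrightarrow> sum f A \<in> L2"
  by (induction A rule: infinite_finite_induct) auto

lemma conj_fun_simps [simp]:
  "conj_fun (f + g) = conj_fun f + conj_fun g" "conj_fun (f - g) = conj_fun f - conj_fun g"
  "conj_fun (f * g) = conj_fun f * conj_fun g" "conj_fun (conj_fun f) = f"
  "conj_fun (cscale c f) = cscale (cnj c) (conj_fun f)" "conj_fun 0 = 0" "conj_fun 1 = 1"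
  by (transfer; auto simp: circle_ae_eq_def)+

lemma zpow_0 [simp]: "zpow 0 = 1"
  by transfer (auto simp: circle_ae_eq_def)

lemma zpow_mult: "zpow m * zpow n = zpow (m + n)"
proof (transfer, unfold circle_ae_eq_def, intro conjI)
  fix m n
  show "AE x in circle_measure. x powi m * x powi n = x powi (m + n)"
    using AE_circle_nonzero by eventually_elim (simp add: power_int_add)
qed auto

lemma conj_zpow [simp]: "conj_fun (zpow n) = zpow (- n)"
proof (transfer, unfold circle_ae_eq_def, intro conjI)
  fix n :: int
  show "AE x in circle_measure. cnj (x powi n) = x powi (- n)"
    using AE_circle_cnj by eventually_elim (simp add: power_int_minus power_int_inverse)
qed auto

lemma zpow_Linf [intro, simp]: "zpow n \<in> Linf"
  unfolding Linf_def mem_Collect_eq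
proof transfer
  fix n :: int
  have "AE x in circle_measure. cmod (x powi n) \<le> 1"
    using AE_circle_norm by eventually_elim (simp add: norm_power_int)
  then show "\<exists>C. AE x in circle_measure. cmod (x powi n) \<le> C" ..
qed

lemma zpow_L2 [intro, simp]: "zpow n \<in> L2"
  by (rule Linf_imp_L2) simp

lemma unimodular_conj: "unimodular f \<Longrightarrow> f * conj_fun f = 1"
proof transfer
  fix f :: "complex \<Rightarrow> complex"
  assume f: "circle_ae_eq f f" "AE x in circle_measure. cmod (f x) = 1"
  from f(2) have "AE x in circle_measure. f x * cnj (f x) = 1"
    by eventually_elim (simp flip: complex_norm_square)
  with f(1) show "circle_ae_eq (\<lambda>x. f x * cnj (f x)) (\<lambda>x. 1)"
    by (simp add: circle_ae_eq_def borel_measurable_circle)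
qed

lemma cinner_add_left:
  "f \<in> L2 \<Longrightarrow> g \<in> L2 \<Longrightarrow> h \<in> L2 \<Longrightarrow> cinner (f + g) h = cinner f h + cinner g h"
  unfolding cinner_def L2_def mem_Collect_eq
  by transfer (simp add: distrib_right integrable_mult_square)

lemma cinner_cscale_left: "cinner (cscale c f) g = c * cinner f g"
  unfolding cinner_def by transfer (simp add: mult.assoc)

lemma cmod_mult_cnj: "z * cnj z = (complex_of_real (cmod z))\<^sup>2"
  by (simp add: complex_norm_square flip: of_real_power)

lemma cinner_commute: "cinner f g = cnj (cinner g f)"
  unfolding cinner_def by transfer (subst Bochner_Integration.integral_cnj[symmetric], simp add: mult.commute del: Bochner_Integration.integral_cnj)

lemma cinner_mult_left: "cinner (u * f) g = cinner f (conj_fun u * g)"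
  unfolding cinner_def by (simp add: ac_simps)

lemma cinner_add_right:
  "f \<in> L2 \<Longrightarrow> g \<in> L2 \<Longrightarrow> h \<in> L2 \<Longrightarrow> cinner h (f + g) = cinner h f + cinner h g"
  by (metis cinner_add_left cinner_commute complex_cnj_add)

lemma cinner_cscale_right: "cinner f (cscale c g) = cnj c * cinner f g"
  by (metis cinner_cscale_left cinner_commute complex_cnj_mult)

lemma cinner_diff_left:
  "f \<in> L2 \<Longrightarrow> g \<in> L2 \<Longrightarrow> h \<in> L2 \<Longrightarrow> cinner (f - g) h = cinner f h - cinner g h"
proof -
  assume "f \<in> L2" "g \<in> L2" "h \<in> L2"
  moreover have "f - g = f + cscale (-1) g" by (simp flip: uminus_eq_cscale)
  ultimately show "cinner (f - g) h = cinner f h - cinner g h"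
    by (simp only: cinner_add_left L2_cscale cinner_cscale_left) simp
qed

lemma cinner_diff_right:
  "f \<in> L2 \<Longrightarrow> g \<in> L2 \<Longrightarrow> h \<in> L2 \<Longrightarrow> cinner h (f - g) = cinner h f - cinner h g"
  by (metis cinner_diff_left cinner_commute complex_cnj_diff)

lemma cinner_zero [simp]: "cinner 0 f = 0" "cinner f 0 = 0"
  unfolding cinner_def by (transfer; simp)+

lemma cinner_sum_left:
  "(\<And>i. i \<in> A \<Longrightarrow> f i \<in> L2) \<Longrightarrow> h \<in> L2 \<Longrightarrow> cinner (sum f A) h = (\<Sum>i\<in>A. cinner (f i) h)"
  by (induction A rule: infinite_finite_induct) (auto simp: cinner_add_left L2_sum)

lemma cinner_sum_right:
  "(\<And>i. i \<in> A \<Longrightarrow> f i \<in> L2) \<Longrightarrow> h \<in> L2 \<Longrightarrow> cinner h (sum f A) = (\<Sum>i\<in>A. cinner h (f i))"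
  by (induction A rule: infinite_finite_induct) (auto simp: cinner_add_right L2_sum)

section \<open>Norm, Cauchy-Schwarz inequality and completeness of \<open>L2\<close>\<close>

text \<open>Kept squared, and as a plain function instead of a type class norm, because the type
  also contains classes outside \<open>L2\<close>. The real part loses nothing by
  \<open>cinner_self\<close>.\<close>

definition sqnorm :: "circle_fun \<Rightarrow> real" where
  "sqnorm f = Re (cinner f f)"

lemma cinner_self_abs:
  assumes "F \<in> borel_measurable borel"
  shows "cinner (abs_circle_fun F) (abs_circle_fun F) = of_real (LINT x|circle_measure. (cmod (F x))\<^sup>2)"
proof -
  have "cinner (abs_circle_fun F) (abs_circle_fun F) = (LINT x|circle_measure. F x * cnj (F x))"
    unfolding cinner_def using assms
    by (simp add: conj_fun.abs_eq times_circle_fun.abs_eq circle_integral.abs_eq)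
  also have "\<dots> = (LINT x|circle_measure. complex_of_real ((cmod (F x))\<^sup>2))"
    by (intro Bochner_Integration.integral_cong refl) (rule complex_norm_square[symmetric])
  finally show ?thesis by (simp only: integral_complex_of_real)
qed

lemma cinner_self: "cinner f f = of_real (sqnorm f)"
proof -
  obtain F where "F \<in> borel_measurable borel" "f = abs_circle_fun F" by (rule circle_fun_abs_cases)
  then show ?thesis by (simp add: sqnorm_def cinner_self_abs)
qed

lemma sqnorm_nonneg [simp]: "sqnorm f \<ge> 0"
proof -
  obtain F where "F \<in> borel_measurable borel" "f = abs_circle_fun F" by (rule circle_fun_abs_cases)
  then show ?thesis by (simp add: sqnorm_def cinner_self_abs)
qed

lemma L2_abs: "F \<in> borel_measurable borel \<Longrightarrow>
    abs_circle_fun F \<in> L2 \<longleftrightarrow> integrable circle_measure (\<lambda>x. (cmod (F x))\<^sup>2)"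
  unfolding L2_def by (simp add: square_integrable.abs_eq)

lemma sqnorm_eq_0:
  assumes "f \<in> L2" "sqnorm f = 0"
  shows "f = 0"
proof -
  obtain F where F [measurable]: "F \<in> borel_measurable borel" and f: "f = abs_circle_fun F"
    by (rule circle_fun_abs_cases)
  have "integrable circle_measure (\<lambda>x. (cmod (F x))\<^sup>2)" "(LINT x|circle_measure. (cmod (F x))\<^sup>2) = 0"
    using assms by (auto simp: f sqnorm_def L2_abs cinner_self_abs)
  then have "AE x in circle_measure. F x = 0"
    by (subst (asm) integral_nonneg_eq_0_iff_AE) auto
  then have "circle_ae_eq F (\<lambda>_. 0)" using F by (simp add: circle_ae_eq_def borel_measurable_circle)
  then show ?thesis
    unfolding f zero_circle_fun_def by (rule Quotient3_rel_abs[OF Quotient3_circle_fun])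
qed

lemma sqnorm_diff:
  assumes "f \<in> L2" "g \<in> L2"
  shows "sqnorm (f - g) = sqnorm f - 2 * Re (cinner f g) + sqnorm g"
proof -
  have "cinner (f - g) (f - g) = cinner f f - cinner f g - cnj (cinner f g) + cinner g g"
    using assms by (simp add: cinner_diff_left cinner_diff_right L2_diff cinner_commute[of g f])
  then show ?thesis by (simp add: sqnorm_def)
qed

lemma cinner_Cauchy_Schwarz:
  assumes f: "f \<in> L2" and g: "g \<in> L2"
  shows "(cmod (cinner f g))\<^sup>2 \<le> sqnorm f * sqnorm g"
proof (cases "sqnorm g = 0")
  case True
  then show ?thesis using sqnorm_eq_0[OF g] by simp
next
  case False
  then have pos: "sqnorm g > 0" using sqnorm_nonneg[of g] by linarith
  \<comment> \<open>\<open>cscale c g\<close> is the projection of f onto the line through g; the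
    inequality expresses that the remainder has nonnegative squared norm.\<close>
  define c where "c = cinner f g / of_real (sqnorm g)"
  have "sqnorm (cscale c g) = (cmod c)\<^sup>2 * sqnorm g"
  proof -
    have "cinner (cscale c g) (cscale c g) = (c * cnj c) * cinner g g"
      by (simp add: cinner_cscale_left cinner_cscale_right)
    also have "\<dots> = of_real ((cmod c)\<^sup>2 * sqnorm g)"
      by (simp add: cmod_mult_cnj cinner_self)
    finally show ?thesis by (simp add: sqnorm_def)
  qed
  moreover have "Re (cinner f (cscale c g)) = (cmod (cinner f g))\<^sup>2 / sqnorm g"
    unfolding cinner_cscale_right c_def
    by (simp add: mult.commute[of "cnj _"] flip: complex_norm_square)
  moreover have "(cmod c)\<^sup>2 * sqnorm g = (cmod (cinner f g))\<^sup>2 / sqnorm g"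
    using pos by (simp add: c_def norm_divide power2_eq_square)
  moreover have "0 \<le> sqnorm (f - cscale c g)" by simp
  ultimately have "(cmod (cinner f g))\<^sup>2 / sqnorm g \<le> sqnorm f"
    using sqnorm_diff[OF f L2_cscale[OF g], of c] by simp
  then show ?thesis using pos by (simp add: field_simps)
qed

lemma cinner_tendsto_right:
  assumes "\<And>k. s k \<in> L2" "f \<in> L2" "h \<in> L2" "(\<lambda>k. sqnorm (f - s k)) \<longlonglongrightarrow> 0"
  shows "(\<lambda>k. cinner h (s k)) \<longlonglongrightarrow> cinner h f"
proof -
  have "(\<lambda>k. sqrt (sqnorm h * sqnorm (f - s k))) \<longlonglongrightarrow> sqrt (sqnorm h * 0)"
    by (intro tendsto_intros assms)
  then have "(\<lambda>k. sqrt (sqnorm h * sqnorm (f - s k))) \<longlonglongrightarrow> 0" by simp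
  moreover have "cmod (cinner h (f - s k)) \<le> sqrt (sqnorm h * sqnorm (f - s k))" for k
    by (intro real_le_rsqrt cinner_Cauchy_Schwarz L2_diff assms)
  ultimately have "(\<lambda>k. cinner h (f - s k)) \<longlonglongrightarrow> 0"
    by (intro Lim_null_comparison[of "\<lambda>k. cinner h (f - s k)"] always_eventually allI)
  then have "(\<lambda>k. cinner h f - cinner h (f - s k)) \<longlonglongrightarrow> cinner h f - 0"
    by (intro tendsto_intros)
  then show ?thesis using assms by (simp add: cinner_diff_right)
qed

text \<open>The geometric rate is the form that \<open>square_complete\<close> takes;
  \<open>Riesz_projection_aux\<close> reaches it by passing to a subsequence of partial
  sums.\<close>

lemma L2_complete:
  assumes s: "\<And>k. s k \<in> L2" and "\<And>k m. k \<le> m \<Longrightarrow> sqnorm (s m - s k) \<le> (1/4)^k"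
  obtains f where "f \<in> L2" "(\<lambda>k. sqnorm (f - s k)) \<longlonglongrightarrow> 0"
proof -
  have "\<forall>k. \<exists>F. F \<in> borel_measurable borel \<and> s k = abs_circle_fun F"
    by (metis circle_fun_abs_cases)
  then obtain F where F [measurable]: "\<And>k. F k \<in> borel_measurable borel" "\<And>k. s k = abs_circle_fun (F k)"
    by metis
  have nn: "(\<integral>\<^sup>+x. ennreal ((cmod (H x))\<^sup>2) \<partial>circle_measure) = ennreal (sqnorm (abs_circle_fun H))"
    if "H \<in> borel_measurable borel" "abs_circle_fun H \<in> L2" for H
    using that by (simp add: sqnorm_def cinner_self_abs nn_integral_eq_integral L2_abs)
  have diff: "s m - s k = abs_circle_fun (\<lambda>x. F m x - F k x)" for m k
    by (simp add: F minus_circle_fun.abs_eq)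
  obtain G where G [measurable]: "G \<in> borel_measurable circle_measure"
    and GF: "\<And>k. (\<integral>\<^sup>+x. ennreal ((cmod (G x - F k x))\<^sup>2) \<partial>circle_measure) \<le> ennreal ((1/4) ^ k)"
  proof (rule square_complete[of F circle_measure])
    show "(\<integral>\<^sup>+x. ennreal ((cmod (F m x - F k x))\<^sup>2) \<partial>circle_measure) \<le> ennreal ((1/4) ^ k)"
      if "k \<le> m" for k m
      using assms(2)[OF that] L2_diff[OF s s, of m k] unfolding diff by (subst nn) (auto intro: ennreal_leI)
  qed (auto simp: borel_measurable_circle circle.finite_measure_axioms)
  have Gb [measurable]: "G \<in> borel_measurable borel" using G by (simp add: borel_measurable_circle)
  let ?G = "abs_circle_fun G"
  have GFk: "?G - s k = abs_circle_fun (\<lambda>x. G x - F k x)" for k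
    by (simp add: F Gb minus_circle_fun.abs_eq)
  have L2: "?G - s k \<in> L2" for k
    unfolding GFk
  proof (subst L2_abs)
    show "integrable circle_measure (\<lambda>x. (cmod (G x - F k x))\<^sup>2)"
      using GF[of k] by (intro integrableI_bounded) (auto intro: le_less_trans)
  qed simp
  show thesis
  proof
    show "?G \<in> L2" using L2_add[OF L2[of 0] s[of 0]] by simp
    have "sqnorm (?G - s k) \<le> (1/4)^k" for k
      using GF[of k] L2[of k] unfolding GFk by (subst (asm) nn) auto
    then show "(\<lambda>k. sqnorm (?G - s k)) \<longlonglongrightarrow> 0"
      by (intro tendsto_sandwich[OF _ _ tendsto_const LIMSEQ_power_zero[of "1/4::real"]]) auto
  qed
qed

section \<open>Fourier coefficients and the Riesz projection\<close>

lemma fourier_coeff_eq_cinner: "fourier_coeff f n = cinner f (zpow n)"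
  unfolding cinner_def conj_zpow by transfer simp

lemma fourier_coeff_simps [simp]:
  "f \<in> L2 \<Longrightarrow> g \<in> L2 \<Longrightarrow> fourier_coeff (f + g) n = fourier_coeff f n + fourier_coeff g n"
  "f \<in> L2 \<Longrightarrow> g \<in> L2 \<Longrightarrow> fourier_coeff (f - g) n = fourier_coeff f n - fourier_coeff g n"
  "fourier_coeff (cscale c f) n = c * fourier_coeff f n"
  "fourier_coeff 0 n = 0"
  by (simp_all add: fourier_coeff_eq_cinner cinner_add_left cinner_diff_left cinner_cscale_left)

lemma fourier_coeff_zpow_mult [simp]: "fourier_coeff (zpow k * f) n = fourier_coeff f (n - k)"
  by (simp add: fourier_coeff_eq_cinner cinner_mult_left zpow_mult)

lemma fourier_coeff_1 [simp]: "fourier_coeff 1 n = (if n = 0 then 1 else 0)"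
  by transfer (simp add: circle_integral_powi)

lemma fourier_coeff_zpow [simp]: "fourier_coeff (zpow k) n = (if n = k then 1 else 0)"
  using fourier_coeff_zpow_mult[of k 1 n] by simp

lemma fourier_coeff_conj: "fourier_coeff (conj_fun f) n = cnj (fourier_coeff f (- n))"
proof -
  have "cinner (conj_fun f) (zpow n) = cinner (zpow (- n)) f"
    unfolding cinner_def by (simp add: mult.commute)
  then show ?thesis by (simp add: fourier_coeff_eq_cinner cinner_commute[of _ f])
qed

text \<open>On a probability space square integrability implies integrability, so a representative
  satisfies \<open>null_fourier\<close> and vanishes almost everywhere.\<close>

lemma fourier_coeff_unique:
  assumes "f \<in> L2" "\<And>n. fourier_coeff f n = 0"
  shows "f = 0"
proof -
  obtain F where F [measurable]: "F \<in> borel_measurable borel" and f: "f = abs_circle_fun F"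
    by (rule circle_fun_abs_cases)
  have int: "integrable circle_measure (\<lambda>x. (cmod (F x))\<^sup>2)" using assms(1) by (simp add: f L2_abs)
  have "integrable circle_measure (\<lambda>x. F x * 1)"
    using int by (intro integrable_mult_square) auto
  moreover have "(LINT x|circle_measure. F x * x powi n) = 0" for n
    using assms(2)[of "- n"] by (simp add: f fourier_coeff.abs_eq)
  ultimately have "null_fourier F" by (simp add: null_fourier_def)
  then have "AE x in circle_measure. F x = 0" by (rule null_fourier_AE)
  then have "circle_ae_eq F (\<lambda>_. 0)" using F by (simp add: circle_ae_eq_def borel_measurable_circle)
  then show ?thesis
    unfolding f zero_circle_fun_def by (rule Quotient3_rel_abs[OF Quotient3_circle_fun])
qed

lemma fourier_coeff_eqI:
  assumes "f \<in> L2" "g \<in> L2" "\<And>n. fourier_coeff f n = fourier_coeff g n"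
  shows "f = g"
  using fourier_coeff_unique[of "f - g"] assms by (simp add: L2_diff)

lemma sqnorm_zpow_sum:
  assumes "finite A"
  shows "sqnorm (\<Sum>k\<in>A. cscale (c k) (zpow k)) = (\<Sum>k\<in>A. (cmod (c k))\<^sup>2)"
proof -
  let ?s = "\<Sum>k\<in>A. cscale (c k) (zpow k)"
  have s: "?s \<in> L2" by auto
  have "cinner ?s ?s = (\<Sum>k\<in>A. cnj (c k) * fourier_coeff ?s k)"
    using s by (subst cinner_sum_right) (auto simp: cinner_cscale_right fourier_coeff_eq_cinner)
  also have "\<dots> = (\<Sum>k\<in>A. cnj (c k) * (\<Sum>j\<in>A. c j * (if j = k then 1 else 0)))"
    unfolding fourier_coeff_eq_cinner
    by (subst cinner_sum_left)
      (auto simp: cinner_cscale_left fourier_coeff_zpow simp flip: fourier_coeff_eq_cinner intro!: sum.cong)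
  also have "\<dots> = (\<Sum>k\<in>A. complex_of_real ((cmod (c k))\<^sup>2))"
    using assms
    by (intro sum.cong refl) (simp add: if_distrib[where f="\<lambda>x. _ * x"] cmod_mult_cnj mult.commute[of "cnj _"] cong: if_cong)
  finally show ?thesis by (simp add: sqnorm_def)
qed

text \<open>The squared norm of f minus its Fourier sum over \<open>A\<close> is
  nonnegative.\<close>

lemma Bessel:
  assumes f: "f \<in> L2" and A: "finite A"
  shows "(\<Sum>k\<in>A. (cmod (fourier_coeff f k))\<^sup>2) \<le> sqnorm f"
proof -
  let ?s = "\<Sum>k\<in>A. cscale (fourier_coeff f k) (zpow k)"
  have "cinner f ?s = (\<Sum>k\<in>A. complex_of_real ((cmod (fourier_coeff f k))\<^sup>2))"
    using f by (subst cinner_sum_right)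
      (auto simp: cinner_cscale_right cmod_mult_cnj mult.commute[of "cnj _"] simp flip: fourier_coeff_eq_cinner)
  then have "Re (cinner f ?s) = (\<Sum>k\<in>A. (cmod (fourier_coeff f k))\<^sup>2)" by simp
  moreover have "?s \<in> L2" by auto
  ultimately show ?thesis
    using sqnorm_diff[OF f, of ?s] sqnorm_zpow_sum[OF A, of "fourier_coeff f"] sqnorm_nonneg[of "f - ?s"]
    by linarith
qed

lemma H2_L2 [intro]: "f \<in> H2 \<Longrightarrow> f \<in> L2"
  by (simp add: H2_def)

text \<open>By Bessel the partial sums over nonnegative frequencies form a Cauchy sequence, and the
  limit is g. The last conclusion carries orthogonality from the partial sums to g, which serves
  below in place of Parseval's identity.\<close>

lemma Riesz_projection_aux:
  assumes f: "f \<in> L2"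
  obtains g where "g \<in> H2" "\<And>n. n \<ge> 0 \<Longrightarrow> fourier_coeff g n = fourier_coeff f n"
    "\<And>h. h \<in> L2 \<Longrightarrow> (\<And>n. n \<ge> 0 \<Longrightarrow> fourier_coeff h n = 0) \<Longrightarrow> cinner h g = 0"
proof -
  let ?a = "\<lambda>k. (cmod (fourier_coeff f (int k)))\<^sup>2"
  define s where "s N = (\<Sum>k\<in>int ` {..<N}. cscale (fourier_coeff f k) (zpow k))" for N
  have s [simp]: "s N \<in> L2" for N unfolding s_def by auto
  have s_eq: "s N = (\<Sum>k<N. cscale (fourier_coeff f (int k)) (zpow (int k)))" for N
    unfolding s_def by (subst sum.reindex) auto
  have sd: "sqnorm (s m - s n) = (\<Sum>k\<in>{n..<m}. ?a k)" if "n \<le> m" for n m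
  proof -
    have "s m - s n = (\<Sum>k\<in>{n..<m}. cscale (fourier_coeff f (int k)) (zpow (int k)))"
      unfolding s_eq using sum_diff_nat_ivl[of 0 n m] that by (simp add: lessThan_atLeast0)
    also have "\<dots> = (\<Sum>k\<in>int ` {n..<m}. cscale (fourier_coeff f k) (zpow k))"
      by (subst sum.reindex) auto
    finally show ?thesis using sqnorm_zpow_sum[of "int ` {n..<m}" "fourier_coeff f"]
      by (simp add: sum.reindex)
  qed
  have "(\<Sum>k\<le>N. ?a k) \<le> sqnorm f" for N
    using Bessel[OF f, of "int ` {..N}"] by (simp add: sum.reindex)
  then have "summable ?a"
    by (intro bounded_imp_summable[where B="sqnorm f"]) auto
  then have "\<exists>N. \<forall>m\<ge>N. \<forall>n. norm (sum ?a {m..<n}) < (1/4) ^ k" for k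
    by (simp add: summable_Cauchy)
  then obtain r where r: "\<And>k m n. m \<ge> r k \<Longrightarrow> norm (sum ?a {m..<n}) < (1/4) ^ k" by metis
  \<comment> \<open>Cumulative sums are monotone and dominate \<open>r\<close>; the + 1 forces
    \<open>q k\<close> to infinity, so that every single coefficient is eventually reached.\<close>
  define q where "q k = (\<Sum>i\<le>k. r i + 1)" for k :: nat
  have q_mono: "q k \<le> q m" if "k \<le> m" for k m
    unfolding q_def using that by (intro sum_mono2) auto
  have q_ge: "q k \<ge> r k" for k unfolding q_def
    using member_le_sum[of k "{..k}" "\<lambda>i. r i + 1"] by auto
  have "sqnorm (s (q m) - s (q k)) \<le> (1/4) ^ k" if "k \<le> m" for k m
    using sd[OF q_mono[OF that]] r[of k "q k" "q m"] q_ge[of k] by simp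
  then obtain g where g: "g \<in> L2" "(\<lambda>k. sqnorm (g - s (q k))) \<longlonglongrightarrow> 0"
    using L2_complete[of "\<lambda>k. s (q k)"] by auto
  have lim: "(\<lambda>k. cinner h (s (q k))) \<longlonglongrightarrow> cinner h g" if "h \<in> L2" for h
    using g that by (intro cinner_tendsto_right) auto
  have sc: "fourier_coeff (s N) n = (if 0 \<le> n \<and> n < int N then fourier_coeff f n else 0)" for N n
  proof -
    have "fourier_coeff (s N) n = (\<Sum>k\<in>int ` {..<N}. fourier_coeff f k * fourier_coeff (zpow k) n)"
      unfolding s_def fourier_coeff_eq_cinner by (subst cinner_sum_left) (auto simp: cinner_cscale_left)
    also have "\<dots> = (if n \<in> int ` {..<N} then fourier_coeff f n else 0)"
      by (simp add: if_distrib[where f="\<lambda>x. _ * x"] cong: if_cong)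
    also have "n \<in> int ` {..<N} \<longleftrightarrow> 0 \<le> n \<and> n < int N"
      by (auto simp: image_iff intro!: bexI[of _ "nat n"])
    finally show ?thesis .
  qed
  have qk: "q k \<ge> k" for k
    unfolding q_def using sum_mono[of "{..k}" "\<lambda>_. 1" "\<lambda>i. r i + 1"] by simp
  have gc: "fourier_coeff g n = (if 0 \<le> n then fourier_coeff f n else 0)" for n
  proof -
    have "(\<lambda>k. cnj (cinner (zpow n) (s (q k)))) \<longlonglongrightarrow> cnj (cinner (zpow n) g)"
      by (intro tendsto_intros lim) auto
    then have "(\<lambda>k. fourier_coeff (s (q k)) n) \<longlonglongrightarrow> fourier_coeff g n"
      unfolding fourier_coeff_eq_cinner by (simp flip: cinner_commute)
    moreover have "eventually (\<lambda>k. fourier_coeff (s (q k)) n = (if 0 \<le> n then fourier_coeff f n else 0)) sequentially"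
      using eventually_gt_at_top[of "nat n"]
    proof eventually_elim
      case (elim k)
      then show ?case using qk[of k] by (auto simp: sc)
    qed
    then have "(\<lambda>k. fourier_coeff (s (q k)) n) \<longlonglongrightarrow> (if 0 \<le> n then fourier_coeff f n else 0)"
      by (rule tendsto_eventually)
    ultimately show ?thesis by (rule LIMSEQ_unique)
  qed
  show thesis
  proof
    show "g \<in> H2" using g by (auto simp: H2_def gc)
    show "fourier_coeff g n = fourier_coeff f n" if "n \<ge> 0" for n using that by (simp add: gc)
    fix h assume h: "h \<in> L2" "\<And>n. n \<ge> 0 \<Longrightarrow> fourier_coeff h n = 0"
    have "cinner h (s N) = 0" for N
      unfolding s_def using h
      by (subst cinner_sum_right) (auto simp: cinner_cscale_right simp flip: fourier_coeff_eq_cinner intro!: sum.neutral)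
    then show "cinner h g = 0"
      using lim[OF h(1)] by (simp add: LIMSEQ_const_iff)
  qed
qed

section \<open>Frequency supports\<close>

text \<open>\<open>below 0\<close> is the orthogonal complement of \<open>H2\<close> in
  \<open>L2\<close>, and \<open>below 1\<close> consists of the conjugates of \<open>H2\<close>
  functions. Larger bounds keep track of multiplication by polynomials.\<close>

definition below :: "int \<Rightarrow> circle_fun set" where
  "below k = {f \<in> L2. \<forall>n\<ge>k. fourier_coeff f n = 0}"

lemma below_L2 [intro]: "f \<in> below k \<Longrightarrow> f \<in> L2"
  by (simp add: below_def)

lemma H2_add [intro]: "f \<in> H2 \<Longrightarrow> g \<in> H2 \<Longrightarrow> f + g \<in> H2"
  and H2_diff [intro]: "f \<in> H2 \<Longrightarrow> g \<in> H2 \<Longrightarrow> f - g \<in> H2"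
  and H2_cscale [intro]: "f \<in> H2 \<Longrightarrow> cscale c f \<in> H2"
  and H2_zero [intro, simp]: "0 \<in> H2"
  and H2_one [intro, simp]: "1 \<in> H2"
  and H2_zpow_mult [intro]: "f \<in> H2 \<Longrightarrow> m \<ge> 0 \<Longrightarrow> zpow m * f \<in> H2"
  by (auto simp: H2_def)

lemma below_add [intro]: "f \<in> below k \<Longrightarrow> g \<in> below k \<Longrightarrow> f + g \<in> below k"
  and below_cscale [intro]: "f \<in> below k \<Longrightarrow> cscale c f \<in> below k"
  and below_zero [intro, simp]: "0 \<in> below k"
  and below_zpow_mult: "f \<in> below k \<Longrightarrow> zpow m * f \<in> below (k + m)"
  and below_mono: "f \<in> below k \<Longrightarrow> k \<le> m \<Longrightarrow> f \<in> below m"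
  by (auto simp: below_def)

lemma H2_zpow [intro, simp]: "m \<ge> 0 \<Longrightarrow> zpow m \<in> H2"
  using H2_zpow_mult[of 1 m] by simp

text \<open>By uniqueness of coefficients g is its own Riesz projection, and it inherits the
  orthogonality that was proved for the projection.\<close>

lemma H2_below_orthogonal:
  assumes "f \<in> below 0" "g \<in> H2"
  shows "cinner f g = 0" "cinner g f = 0"
proof -
  obtain g' where g': "g' \<in> H2" "\<And>n. n \<ge> 0 \<Longrightarrow> fourier_coeff g' n = fourier_coeff g n"
    "\<And>h. h \<in> L2 \<Longrightarrow> (\<And>n. n \<ge> 0 \<Longrightarrow> fourier_coeff h n = 0) \<Longrightarrow> cinner h g' = 0"
    using assms by (blast intro: Riesz_projection_aux)
  have "g' = g"
  proof (rule fourier_coeff_eqI)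
    show "fourier_coeff g' n = fourier_coeff g n" for n
      using g'(1,2) assms(2) by (cases "n \<ge> 0") (auto simp: H2_def)
  qed (use g' assms in auto)
  then show "cinner f g = 0" using g'(3)[of f] assms(1) by (auto simp: below_def)
  then show "cinner g f = 0" by (subst cinner_commute) simp
qed

lemma H2_below_trivial: "f \<in> H2 \<Longrightarrow> f \<in> below 0 \<Longrightarrow> f = 0"
  by (rule fourier_coeff_unique) (auto simp: H2_def below_def linorder_not_le[symmetric])

lemma L2_decomp:
  assumes "f \<in> L2"
  obtains g h where "f = g + h" "g \<in> H2" "h \<in> below 0"
proof -
  obtain g where g: "g \<in> H2" "\<And>n. n \<ge> 0 \<Longrightarrow> fourier_coeff g n = fourier_coeff f n"
    using assms by (blast intro: Riesz_projection_aux)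
  have "f - g \<in> below 0" using g assms by (auto simp: below_def H2_def)
  then show thesis using that[of g "f - g"] g by simp
qed

lemma conj_H2_below: "f \<in> H2 \<Longrightarrow> conj_fun f \<in> below 1"
  by (auto simp: H2_def below_def fourier_coeff_conj)

lemma conj_below_H2: "f \<in> below 1 \<Longrightarrow> conj_fun f \<in> H2"
  by (auto simp: H2_def below_def fourier_coeff_conj)

text \<open>The coefficient of f g at n < 0 is the inner product of g with z^n conj(f), whose
  frequencies are at most n and thus negative.\<close>

lemma Hinf_mult_H2:
  assumes "f \<in> Hinf" "g \<in> H2"
  shows "f * g \<in> H2"
proof -
  have "fourier_coeff (f * g) n = 0" if "n < 0" for n
  proof -
    have "zpow n * conj_fun f \<in> below (1 + n)"
      using assms by (intro below_zpow_mult conj_H2_below) (auto simp: Hinf_def)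
    then have "zpow n * conj_fun f \<in> below 0" using that by (auto intro: below_mono)
    then have "cinner g (zpow n * conj_fun f) = 0" using assms(2) by (rule H2_below_orthogonal)
    then show ?thesis
      by (simp add: fourier_coeff_eq_cinner cinner_mult_left mult.commute)
  qed
  then show ?thesis using assms by (auto simp: H2_def Hinf_def)
qed

lemma inner_function_conj:
  assumes "inner_function \<theta>"
  shows "\<theta> * conj_fun \<theta> = 1" "conj_fun \<theta> * \<theta> = 1" "\<theta> * (conj_fun \<theta> * f) = f" "conj_fun \<theta> * (\<theta> * f) = f"
proof -
  show 1: "\<theta> * conj_fun \<theta> = 1" using assms unimodular_conj by (simp add: inner_function_def)
  then show 2: "conj_fun \<theta> * \<theta> = 1" by (simp add: mult.commute)
  show "\<theta> * (conj_fun \<theta> * f) = f" "conj_fun \<theta> * (\<theta> * f) = f"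
    by (simp_all add: 1 2 flip: mult.assoc)
qed

lemma inner_function_Hinf: "inner_function \<theta> \<Longrightarrow> \<theta> \<in> Hinf"
  and inner_function_Linf: "inner_function \<theta> \<Longrightarrow> \<theta> \<in> Linf"
  and inner_function_H2: "inner_function \<theta> \<Longrightarrow> \<theta> \<in> H2"
  by (auto simp: inner_function_def Hinf_def)

section \<open>The projection onto the model space\<close>

lemma model_space_H2: "f \<in> model_space \<theta> \<Longrightarrow> f \<in> H2"
  by (simp add: model_space_def)

lemma model_space_orthogonal:
  "k \<in> model_space \<theta> \<Longrightarrow> v \<in> H2 \<Longrightarrow> cinner k (\<theta> * v) = 0"
  "k \<in> model_space \<theta> \<Longrightarrow> v \<in> H2 \<Longrightarrow> cinner (\<theta> * v) k = 0"
  by (auto simp: model_space_def cinner_commute[of "\<theta> * v"])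

context
  fixes \<theta> assumes inner: "inner_function \<theta>"
begin

lemma theta_mult_H2: "v \<in> H2 \<Longrightarrow> \<theta> * v \<in> H2"
  using inner by (intro Hinf_mult_H2) (auto simp: inner_function_Hinf)

lemma theta_mult_L2: "v \<in> L2 \<Longrightarrow> \<theta> * v \<in> L2" "v \<in> L2 \<Longrightarrow> conj_fun \<theta> * v \<in> L2"
  using inner by (auto intro: inner_function_Linf L2_Linf_mult Linf_conj)

lemma model_space_add: "f \<in> model_space \<theta> \<Longrightarrow> g \<in> model_space \<theta> \<Longrightarrow> f + g \<in> model_space \<theta>"
  using theta_mult_H2 by (auto simp: model_space_def cinner_add_left H2_L2)

lemma model_space_diff: "f \<in> model_space \<theta> \<Longrightarrow> g \<in> model_space \<theta> \<Longrightarrow> f - g \<in> model_space \<theta>"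
  using theta_mult_H2 by (auto simp: model_space_def cinner_diff_left H2_L2)

lemma model_space_cscale: "f \<in> model_space \<theta> \<Longrightarrow> cscale c f \<in> model_space \<theta>"
  by (auto simp: model_space_def cinner_cscale_left)

text \<open>Both summands besides k are orthogonal to the model space. This evaluates the definite
  description in \<open>orth_proj\<close> whenever a splitting is known, and
  \<open>model_decomp\<close> provides one for each \<open>L2\<close> function.\<close>

lemma orth_proj_model_eq:
  assumes k: "k \<in> model_space \<theta>" and u: "u \<in> below 0" and v: "v \<in> H2"
  shows "orth_proj (model_space \<theta>) (k + u + \<theta> * v) = k"
  unfolding orth_proj_def
proof (rule the_equality)
  let ?f = "k + u + \<theta> * v"
  have L2: "k \<in> L2" "u \<in> L2" "\<theta> * v \<in> L2" "?f \<in> L2"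
    using k u v theta_mult_H2[OF v] by (auto dest: model_space_H2)
  have *: "cinner (u + \<theta> * v) l = 0" if "l \<in> model_space \<theta>" for l
  proof -
    have "l \<in> H2" using that by (rule model_space_H2)
    then show ?thesis
      using L2 that u v by (simp add: cinner_add_left H2_L2 H2_below_orthogonal model_space_orthogonal)
  qed
  show "k \<in> model_space \<theta> \<and> (\<forall>l\<in>model_space \<theta>. cinner (?f - k) l = 0)"
    using k * by (simp add: algebra_simps)
  fix g assume g: "g \<in> model_space \<theta> \<and> (\<forall>l\<in>model_space \<theta>. cinner (?f - g) l = 0)"
  then have gL2: "g \<in> L2" by (auto dest: model_space_H2)
  \<comment> \<open>Uniqueness: the difference of two candidates lies in the model space and is
    orthogonal to it, hence to itself.\<close>
  have d: "k - g \<in> model_space \<theta>" using k g by (auto intro: model_space_diff)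
  have "cinner (?f - g) (k - g) - cinner (u + \<theta> * v) (k - g) = 0"
    using g d * by simp
  then have "cinner ((?f - g) - (u + \<theta> * v)) (k - g) = 0"
    using L2 gL2 by (subst cinner_diff_left) auto
  then have "cinner (k - g) (k - g) = 0" by (simp add: algebra_simps)
  then have "k - g = 0" using L2 gL2 by (intro sqnorm_eq_0) (auto simp: cinner_self)
  then show "g = k" by simp
qed

text \<open>After the Riesz splitting of f, the \<open>H2\<close> part is multiplied by conj(theta)
  and split once more into v + w. The component in the model space is theta w: it is a difference of
  \<open>H2\<close> functions, and it is orthogonal to theta \<open>H2\<close> because w is
  orthogonal to \<open>H2\<close> and theta is unimodular.\<close>

lemma model_decomp:
  assumes f: "f \<in> L2"
  obtains k u v where "f = k + u + \<theta> * v" "k \<in> model_space \<theta>" "u \<in> below 0" "v \<in> H2"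
proof -
  obtain g u where gu: "f = g + u" "g \<in> H2" "u \<in> below 0" using f by (rule L2_decomp)
  obtain v w where vw: "conj_fun \<theta> * g = v + w" "v \<in> H2" "w \<in> below 0"
    using theta_mult_L2(2)[OF H2_L2[OF gu(2)]] by (rule L2_decomp)
  have "g = \<theta> * (conj_fun \<theta> * g)" using inner by (simp add: inner_function_conj)
  then have g: "g = \<theta> * v + \<theta> * w" unfolding vw by (simp add: distrib_left)
  have "\<theta> * w = g - \<theta> * v" using g by simp
  then have "\<theta> * w \<in> H2" using gu vw theta_mult_H2 by auto
  moreover have "cinner (\<theta> * w) (\<theta> * x) = 0" if "x \<in> H2" for x
    using H2_below_orthogonal(1)[OF vw(3) that] inner
    by (simp add: cinner_mult_left inner_function_conj)
  ultimately have "\<theta> * w \<in> model_space \<theta>" by (auto simp: model_space_def)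
  then show thesis using that[of "\<theta> * w" u v] gu(1,3) g vw(2) by (simp add: ac_simps)
qed

abbreviation model_proj :: "circle_fun \<Rightarrow> circle_fun" where
  "model_proj \<equiv> orth_proj (model_space \<theta>)"

lemma model_proj_in: "f \<in> L2 \<Longrightarrow> model_proj f \<in> model_space \<theta>"
  by (metis model_decomp orth_proj_model_eq)

lemma model_proj_add: "f \<in> L2 \<Longrightarrow> g \<in> L2 \<Longrightarrow> model_proj (f + g) = model_proj f + model_proj g"
proof -
  assume "f \<in> L2" "g \<in> L2"
  then obtain k u v k' u' v' where
    *: "f = k + u + \<theta> * v" "k \<in> model_space \<theta>" "u \<in> below 0" "v \<in> H2"
       "g = k' + u' + \<theta> * v'" "k' \<in> model_space \<theta>" "u' \<in> below 0" "v' \<in> H2"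
    by (metis model_decomp)
  have "model_proj ((k + k') + (u + u') + \<theta> * (v + v')) = k + k'"
    using * by (intro orth_proj_model_eq model_space_add) auto
  moreover have "f + g = (k + k') + (u + u') + \<theta> * (v + v')"
    unfolding * by (simp add: algebra_simps)
  moreover have "model_proj f = k" "model_proj g = k'" using * by (simp_all add: orth_proj_model_eq)
  ultimately show ?thesis by simp
qed

lemma model_proj_cscale: "f \<in> L2 \<Longrightarrow> model_proj (cscale c f) = cscale c (model_proj f)"
proof -
  assume "f \<in> L2"
  then obtain k u v where
    *: "f = k + u + \<theta> * v" "k \<in> model_space \<theta>" "u \<in> below 0" "v \<in> H2"
    by (metis model_decomp)
  have "model_proj (cscale c k + cscale c u + \<theta> * cscale c v) = cscale c k"
    using * by (intro orth_proj_model_eq model_space_cscale) auto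
  moreover have "cscale c f = cscale c k + cscale c u + \<theta> * cscale c v"
    unfolding * by (simp add: circle_fun.scale_right_distrib cscale_mult_right)
  ultimately show ?thesis using * by (simp add: orth_proj_model_eq)
qed

lemma model_space_zero: "0 \<in> model_space \<theta>"
  by (simp add: model_space_def)

lemma model_proj_sum: "(\<And>i. i \<in> A \<Longrightarrow> f i \<in> L2) \<Longrightarrow> model_proj (sum f A) = (\<Sum>i\<in>A. model_proj (f i))"
proof (induction A rule: infinite_finite_induct)
  case (insert x A)
  then show ?case by (simp add: model_proj_add L2_sum)
qed (use orth_proj_model_eq[of 0 0 0] model_space_zero in auto)

lemma model_proj_below: "u \<in> below 0 \<Longrightarrow> model_proj u = 0"
  using orth_proj_model_eq[of 0 u 0] model_space_zero by simp

lemma model_proj_theta: "v \<in> H2 \<Longrightarrow> model_proj (\<theta> * v) = 0"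
  using orth_proj_model_eq[of 0 0 v] model_space_zero by simp

lemma model_proj_eq_0:
  assumes "f \<in> L2" "model_proj f = 0"
  obtains u v where "f = u + \<theta> * v" "u \<in> below 0" "v \<in> H2"
proof -
  obtain k u v where *: "f = k + u + \<theta> * v" "k \<in> model_space \<theta>" "u \<in> below 0" "v \<in> H2"
    using assms(1) by (rule model_decomp)
  then have "k = 0" using assms(2) by (simp add: orth_proj_model_eq)
  then show thesis using that[of u v] * by simp
qed

end

section \<open>Polynomials and rational functions on the circle\<close>

lemma borel_measurable_poly [measurable, simp]: "poly (p :: complex poly) \<in> borel_measurable borel"
  by (auto intro!: borel_measurable_continuous_onI continuous_intros)

lemma polyf_abs: "polyf p = abs_circle_fun (poly p)"
  by (simp add: polyf_def)

lemma polyf_simps [simp]: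
  "polyf 0 = 0" "polyf 1 = 1" "polyf (p + q) = polyf p + polyf q" "polyf (p - q) = polyf p - polyf q"
  "polyf (p * q) = polyf p * polyf q" "polyf (smult c p) = cscale c (polyf p)"
  "polyf [:c:] = cscale c 1"
  by (simp_all add: polyf_abs zero_circle_fun_def one_circle_fun_def plus_circle_fun.abs_eq
      minus_circle_fun.abs_eq times_circle_fun.abs_eq cscale.abs_eq)
    (intro arg_cong[where f=abs_circle_fun] ext, simp)+

lemma polyf_pCons: "polyf (pCons a p) = cscale a 1 + zpow 1 * polyf p"
  by (simp add: polyf_abs one_circle_fun_def zpow.abs_eq plus_circle_fun.abs_eq
      times_circle_fun.abs_eq cscale.abs_eq)
    (intro arg_cong[where f=abs_circle_fun] ext, simp)

lemma polyf_linear: "polyf [:-a, 1:] = zpow 1 - cscale a 1"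
  unfolding polyf_pCons by (simp add: polyf_pCons circle_fun.scale_minus_left)

lemma invf_mult: "invf (f * g) = invf f * invf g"
  by transfer (auto simp: circle_ae_eq_def)

lemma Linf_zero [simp]: "0 \<in> Linf"
  using Linf_cscale[OF Linf_one, of 0] by simp

lemma polyf_Linf [intro, simp]: "polyf p \<in> Linf"
  by (induction p) (auto simp: polyf_pCons)

lemma polyf_mult_H2: "f \<in> H2 \<Longrightarrow> polyf p * f \<in> H2"
proof (induction p)
  case (pCons a p)
  have "polyf (pCons a p) * f = cscale a f + zpow 1 * (polyf p * f)"
    by (simp add: polyf_pCons distrib_right cscale_mult_left mult.assoc)
  moreover have "zpow 1 * (polyf p * f) \<in> H2" using pCons by (intro H2_zpow_mult) auto
  ultimately show ?case using pCons.prems by auto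
qed simp

lemma polyf_H2 [intro, simp]: "polyf p \<in> H2"
  using polyf_mult_H2[of 1 p] by simp

lemma polyf_mult_below: "f \<in> below k \<Longrightarrow> polyf p * f \<in> below (k + degree p)"
proof (induction p)
  case (pCons a p)
  have eq: "polyf (pCons a p) * f = cscale a f + zpow 1 * (polyf p * f)"
    by (simp add: polyf_pCons distrib_right cscale_mult_left mult.assoc)
  show ?case
  proof (cases "p = 0")
    \<comment> \<open>Here \<open>pCons a 0\<close> has degree 0 and not 1 +
      \<open>degree 0\<close>, so the shifted term, which is zero, must not be counted.\<close>
    case True
    then show ?thesis unfolding eq using pCons.prems by auto
  next
    case False
    have "zpow 1 * (polyf p * f) \<in> below (k + degree p + 1)"
      using pCons by (intro below_zpow_mult) auto
    then show ?thesis unfolding eq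
      using pCons.prems False by (intro below_add) (auto intro: below_mono simp: add.assoc)
  qed
qed simp

context
  fixes q assumes nz: "\<And>z. cmod z = 1 \<Longrightarrow> poly q z \<noteq> 0"
begin

lemma polyf_invf: "polyf q * invf (polyf q) = 1"
proof -
  have "circle_ae_eq (\<lambda>x. poly q x * inverse (poly q x)) (\<lambda>x. 1)"
    unfolding circle_ae_eq_def
  proof (intro conjI)
    show "(\<lambda>x. poly q x * inverse (poly q x)) \<in> borel_measurable circle_measure"
      by (simp add: borel_measurable_circle)
    show "AE x in circle_measure. poly q x * inverse (poly q x) = 1"
      using AE_circle_norm by eventually_elim (simp add: nz)
  qed auto
  then have "abs_circle_fun (\<lambda>x. poly q x * inverse (poly q x)) = abs_circle_fun (\<lambda>x. 1)"
    by (rule Quotient3_rel_abs[OF Quotient3_circle_fun])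
  then show ?thesis
    by (simp add: polyf_abs invf.abs_eq times_circle_fun.abs_eq one_circle_fun_def)
qed

lemma polyf_invf_cancel [simp]: "polyf q * (invf (polyf q) * f) = f" "invf (polyf q) * (polyf q * f) = f"
  using polyf_invf by (simp_all add: mult.commute[of "invf (polyf q)" "polyf q"] flip: mult.assoc)

lemma invf_polyf_Linf [intro, simp]: "invf (polyf q) \<in> Linf"
proof -
  have "compact ((\<lambda>x. inverse (poly q x)) ` sphere 0 1)"
    using nz by (intro compact_continuous_image continuous_intros) auto
  then have "bounded ((\<lambda>x. inverse (poly q x)) ` sphere 0 1)" by (rule compact_imp_bounded)
  then obtain C where "\<forall>y\<in>(\<lambda>x. inverse (poly q x)) ` sphere 0 1. norm y \<le> C"
    unfolding bounded_iff ..
  then have C: "cmod (inverse (poly q x)) \<le> C" if "cmod x = 1" for x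
    using that by auto
  have "AE x in circle_measure. cmod (inverse (poly q x)) \<le> C"
    using AE_circle_norm by eventually_elim (rule C)
  then show ?thesis unfolding Linf_def
    by (auto simp: polyf_abs invf.abs_eq essentially_bounded.abs_eq)
qed

end

lemma rational_funs_eq: "rational_funs = {polyf p * invf (polyf q) | p q.
     q \<noteq> 0 \<and> (\<forall>z. poly q z = 0 \<longrightarrow> cmod z < 1)}"
proof -
  have "abs_circle_fun (\<lambda>z. poly p z / poly q z) = polyf p * invf (polyf q)" for p q
  proof -
    show ?thesis
      by (simp add: polyf_abs invf.abs_eq times_circle_fun.abs_eq divide_inverse)
  qed
  then show ?thesis unfolding rational_funs_def by simp
qed

lemma H2_below_sum:
  assumes "f \<in> H2" "f \<in> below (int n)"
  shows "f = (\<Sum>k<n. cscale (fourier_coeff f (int k)) (zpow (int k)))"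
proof (rule fourier_coeff_eqI)
  show "(\<Sum>k<n. cscale (fourier_coeff f (int k)) (zpow (int k))) \<in> L2" by auto
  fix m
  have "fourier_coeff (\<Sum>k<n. cscale (fourier_coeff f (int k)) (zpow (int k))) m
      = (\<Sum>k<n. fourier_coeff f (int k) * fourier_coeff (zpow (int k)) m)"
    unfolding fourier_coeff_eq_cinner by (subst cinner_sum_left) (auto simp: cinner_cscale_left)
  also have "\<dots> = (\<Sum>k\<in>int ` {..<n}. fourier_coeff f k * fourier_coeff (zpow k) m)"
    by (subst sum.reindex) auto
  also have "\<dots> = (if m \<in> int ` {..<n} then fourier_coeff f m else 0)"
    by (simp add: if_distrib[where f="\<lambda>x. _ * x"] cong: if_cong)
  also have "m \<in> int ` {..<n} \<longleftrightarrow> 0 \<le> m \<and> m < int n"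
    by (auto simp: image_iff intro!: bexI[of _ "nat m"])
  also have "(if 0 \<le> m \<and> m < int n then fourier_coeff f m else 0) = fourier_coeff f m"
    using assms by (auto simp: H2_def below_def)
  finally show "fourier_coeff f m = fourier_coeff (\<Sum>k<n. cscale (fourier_coeff f (int k)) (zpow (int k))) m" ..
qed (use assms in auto)

text \<open>Only the frequencies 0, ..., n - 1 remain, so f is a polynomial. The extra factor
  \<open>w\<close> is used for the reciprocal of a denominator that was cleared beforehand.\<close>

lemma H2_below_span:
  assumes "f \<in> H2" "f \<in> below (int n)"
  shows "w * f \<in> circle_fun.span ((\<lambda>k. w * zpow (int k)) ` {..<n})"
proof -
  have "w * f = (\<Sum>k<n. cscale (fourier_coeff f (int k)) (w * zpow (int k)))"
    by (subst H2_below_sum[OF assms]) (simp add: sum_distrib_left cscale_mult_right)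
  also have "\<dots> \<in> circle_fun.span ((\<lambda>k. w * zpow (int k)) ` {..<n})"
    by (intro circle_fun.span_sum circle_fun.span_scale circle_fun.span_base) auto
  finally show ?thesis .
qed

text \<open>The negative part v of (p/q) g satisfies q v = p g - q h, which is in \<open>H2\<close>,
  while multiplying v by q raises its frequencies by at most the degree of q. Hence q v is a
  polynomial of degree below that of q, and v ranges over a space that does not depend on g.\<close>

lemma rational_mult_H2:
  assumes nz: "\<And>z. cmod z = 1 \<Longrightarrow> poly q z \<noteq> 0" and g: "g \<in> H2"
  obtains h v where "polyf p * invf (polyf q) * g = h + v" "h \<in> H2"
    "v \<in> circle_fun.span ((\<lambda>k. invf (polyf q) * zpow (int k)) ` {..<degree q})"
proof -
  have "polyf p * invf (polyf q) * g \<in> L2" using nz g by (intro L2_Linf_mult Linf_mult) auto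
  then obtain h v where hv: "polyf p * invf (polyf q) * g = h + v" "h \<in> H2" "v \<in> below 0"
    by (rule L2_decomp)
  have "v = polyf p * invf (polyf q) * g - h" using hv(1) by simp
  then have "polyf q * v = polyf q * (invf (polyf q) * (polyf p * g)) - polyf q * h"
    by (simp add: right_diff_distrib ac_simps)
  then have "polyf q * v \<in> H2" using nz g hv(2) by (auto intro: polyf_mult_H2)
  moreover have "polyf q * v \<in> below (int (degree q))"
    using polyf_mult_below[OF hv(3), of q] by simp
  ultimately have "invf (polyf q) * (polyf q * v)
      \<in> circle_fun.span ((\<lambda>k. invf (polyf q) * zpow (int k)) ` {..<degree q})"
    by (rule H2_below_span)
  then show thesis using that hv nz by simp
qed

section \<open>Division by linear factors and Kronecker's theorem\<close>

lemma fourier_coeff_linear_mult: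
  assumes "v \<in> L2"
  shows "fourier_coeff (polyf [:-a, 1:] * v) n = fourier_coeff v (n - 1) - a * fourier_coeff v n"
proof -
  have "polyf [:-a, 1:] * v = zpow 1 * v - cscale a v"
    by (simp add: polyf_linear left_diff_distrib cscale_mult_left)
  moreover have "zpow 1 * v \<in> L2" "cscale a v \<in> L2" using assms by auto
  ultimately show ?thesis by simp
qed

lemma H2_cscale_cancel:
  assumes "cscale c f \<in> H2" "c \<noteq> 0"
  shows "f \<in> H2"
proof -
  have "f = cscale (1 / c) (cscale c f)" using assms(2) by simp
  also have "\<dots> \<in> H2" using assms(1) by (rule H2_cscale)
  finally show ?thesis .
qed

text \<open>The recursion for the vanishing negative coefficients of (z - a) v makes the
  coefficients of v at -1, -2, ... a geometric progression with ratio a, the expansion of a simple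
  pole at a.\<close>

lemma linear_shift_coeff:
  assumes v: "v \<in> L2" and H2: "polyf [:-a, 1:] * v \<in> H2"
  shows "fourier_coeff v (-1 - int k) = a ^ k * fourier_coeff v (-1)"
proof (induction k)
  case (Suc k)
  have "fourier_coeff (polyf [:-a, 1:] * v) (-1 - int k)
      = fourier_coeff v (-1 - int k - 1) - a * fourier_coeff v (-1 - int k)"
    using v by (rule fourier_coeff_linear_mult)
  moreover have "fourier_coeff (polyf [:-a, 1:] * v) (-1 - int k) = 0"
    using H2 by (simp add: H2_def)
  moreover have "-1 - int k - 1 = -1 - int (Suc k)" by simp
  ultimately show ?case using Suc by simp
qed simp

lemma H2_neg_coeffI:
  assumes "v \<in> L2" "\<And>k. fourier_coeff v (-1 - int k) = 0"
  shows "v \<in> H2"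
proof -
  have "fourier_coeff v n = 0" if "n < 0" for n
    using assms(2)[of "nat (-1 - n)"] that by simp
  then show ?thesis using assms(1) by (simp add: H2_def)
qed

text \<open>A geometric progression with ratio of modulus at least 1 does not decay, so by Bessel
  its first term is zero. Points on the circle itself are included.\<close>

lemma linear_div_outside:
  assumes v: "v \<in> L2" and H2: "polyf [:-a, 1:] * v \<in> H2" and a: "cmod a \<ge> 1"
  shows "v \<in> H2"
proof -
  let ?c = "(cmod (fourier_coeff v (-1)))\<^sup>2"
  have "real N * ?c \<le> sqnorm v" for N
  proof -
    have "?c \<le> (cmod (fourier_coeff v (-1 - int k)))\<^sup>2" for k
      using a unfolding linear_shift_coeff[OF v H2]
      by (simp add: norm_mult norm_power power_mult_distrib mult_le_cancel_right1 one_le_power)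
    then have "(\<Sum>k<N. ?c) \<le> (\<Sum>k<N. (cmod (fourier_coeff v (-1 - int k)))\<^sup>2)"
      by (intro sum_mono)
    also have "\<dots> = (\<Sum>n\<in>(\<lambda>k. -1 - int k) ` {..<N}. (cmod (fourier_coeff v n))\<^sup>2)"
      by (subst sum.reindex) (auto simp: inj_on_def)
    also have "\<dots> \<le> sqnorm v" by (intro Bessel v) auto
    finally show ?thesis by simp
  qed
  then have "?c = 0"
    by (metis reals_Archimedean3 not_less zero_le_power2 order_le_less)
  then show ?thesis
    using v linear_shift_coeff[OF v H2] by (intro H2_neg_coeffI) auto
qed

text \<open>Here v may have a pole part. The reciprocal r of z - a has coefficient 1 at -1, so
  subtracting a multiple of r kills that coefficient of v, and with it the whole
  progression.\<close>

lemma linear_div_inside: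
  assumes v: "v \<in> L2" and H2: "polyf [:-a, 1:] * v \<in> H2" and a: "cmod a < 1"
  obtains c where "v - cscale c (invf (polyf [:-a, 1:])) \<in> H2"
proof -
  define r where "r = invf (polyf [:-a, 1:])"
  have nz: "poly [:-a, 1:] z \<noteq> 0" if "cmod z = 1" for z using that a by auto
  have r: "polyf [:-a, 1:] * r = 1" unfolding r_def using nz by (rule polyf_invf)
  have rL: "r \<in> L2" unfolding r_def using nz by (intro Linf_imp_L2) auto
  have rec: "fourier_coeff r (n - 1) - a * fourier_coeff r n = (if n = 0 then 1 else 0)" for n
    using fourier_coeff_linear_mult[OF rL, of a n] unfolding r by simp
  \<comment> \<open>Run upwards, the recursion bounds the coefficient at 0 by |a|^k times a
    constant, so it is zero; the recursion at index 0 then gives 1 for the coefficient at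
    -1.\<close>
  have pow: "fourier_coeff r 0 = a ^ k * fourier_coeff r (int k)" for k
  proof (induction k)
    case (Suc k)
    have "fourier_coeff r (int k) = a * fourier_coeff r (int (Suc k))"
      using rec[of "int (Suc k)"] by simp
    then show ?case using Suc by simp
  qed simp
  have "cmod (fourier_coeff r 0) \<le> cmod a ^ k * sqrt (sqnorm r)" for k
  proof -
    have "cmod (fourier_coeff r (int k)) \<le> sqrt (sqnorm r)"
      using Bessel[OF rL, of "{int k}"] by (intro real_le_rsqrt) simp
    then show ?thesis
      using pow[of k] by (simp add: norm_mult norm_power mult_left_mono)
  qed
  moreover have "(\<lambda>k. cmod a ^ k * sqrt (sqnorm r)) \<longlonglongrightarrow> 0 * sqrt (sqnorm r)"
    using a by (intro tendsto_intros LIMSEQ_power_zero) simp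
  ultimately have "cmod (fourier_coeff r 0) \<le> 0"
    by (intro LIMSEQ_le_const[of "\<lambda>k. cmod a ^ k * sqrt (sqnorm r)"]) auto
  then have r1: "fourier_coeff r (-1) = 1" using rec[of 0] by simp
  let ?w = "v - cscale (fourier_coeff v (-1)) r"
  have w: "?w \<in> L2" using v rL by auto
  have "polyf [:-a, 1:] * ?w = polyf [:-a, 1:] * v - cscale (fourier_coeff v (-1)) 1"
    using r by (simp add: right_diff_distrib cscale_mult_right)
  then have "polyf [:-a, 1:] * ?w \<in> H2" using H2 by auto
  note lin = linear_shift_coeff[OF w this]
  have "?w \<in> H2"
    using w v rL r1 by (intro H2_neg_coeffI) (simp_all only: lin, auto simp: L2_cscale)
  then show thesis using that r_def by blast
qed

lemma rational_funsI:
  "q \<noteq> 0 \<Longrightarrow> (\<And>z. poly q z = 0 \<Longrightarrow> cmod z < 1) \<Longrightarrow> polyf p * invf (polyf q) \<in> rational_funs"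
  unfolding rational_funs_eq by blast

lemma rational_funsE:
  assumes "r \<in> rational_funs"
  obtains p q where "r = polyf p * invf (polyf q)" "q \<noteq> 0" "\<And>z. poly q z = 0 \<Longrightarrow> cmod z < 1"
    "\<And>z. cmod z = 1 \<Longrightarrow> poly q z \<noteq> 0"
proof -
  obtain p q where *: "r = polyf p * invf (polyf q)" "q \<noteq> 0" "\<forall>z. poly q z = 0 \<longrightarrow> cmod z < 1"
    using assms unfolding rational_funs_eq by blast
  show thesis
  proof (rule that[OF *(1,2)])
    show "cmod z < 1" if "poly q z = 0" for z using *(3) that by blast
    show "poly q z \<noteq> 0" if "cmod z = 1" for z using *(3) that by (metis less_irrefl)
  qed
qed

lemma rational_funs_Linf: "r \<in> rational_funs \<Longrightarrow> r \<in> Linf"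
  by (elim rational_funsE) (auto intro: invf_polyf_Linf)

text \<open>If |a| < 1, the factor z - a joins the denominator and the remaining pole part is merged
  into the numerator. Otherwise no pole at a is allowed, so the numerator is first corrected to be
  divisible by z - a.\<close>

lemma linear_div_rational:
  assumes u: "u \<in> L2" and r: "r \<in> rational_funs" "polyf [:-a, 1:] * u - r \<in> H2"
  obtains r' where "r' \<in> rational_funs" "u - r' \<in> H2"
proof -
  obtain p s where ps: "r = polyf p * invf (polyf s)" "s \<noteq> 0" "\<And>z. poly s z = 0 \<Longrightarrow> cmod z < 1"
    and nz: "\<And>z. cmod z = 1 \<Longrightarrow> poly s z \<noteq> 0"
    using r(1) by (rule rational_funsE) blast
  let ?L = "polyf [:-a, 1:]"
  show thesis
  proof (cases "cmod a < 1")
    case False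
    then have sa: "poly s a \<noteq> 0" using ps by auto
    \<comment> \<open>Chosen so that p - c s vanishes at a. Changing r = p/s by the constant c is
      harmless, since constants belong to \<open>H2\<close>.\<close>
    define c where "c = poly p a / poly s a"
    have "poly (p - smult c s) a = 0" using sa by (simp add: c_def)
    then obtain t where t: "p - smult c s = [:-a, 1:] * t" unfolding poly_eq_0_iff_dvd by (rule dvdE)
    let ?r = "polyf t * invf (polyf s)"
    have tR: "?r \<in> rational_funs" using ps by (intro rational_funsI)
    have "?L * ?r = polyf (p - smult c s) * invf (polyf s)" unfolding t by (simp only: polyf_simps(5) mult.assoc)
    also have "\<dots> = r - cscale c (polyf s * invf (polyf s))"
      by (simp add: ps(1) left_diff_distrib cscale_mult_left)
    also have "polyf s * invf (polyf s) = 1" using nz by (rule polyf_invf)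
    finally have "?L * (u - ?r) = (?L * u - r) + cscale c 1" by (simp add: right_diff_distrib)
    then have H: "?L * (u - ?r) \<in> H2" using r(2) by auto
    have L: "u - ?r \<in> L2" by (intro L2_diff u Linf_imp_L2 rational_funs_Linf tR)
    have "u - ?r \<in> H2" by (rule linear_div_outside[OF L H]) (use False in simp)
    then show thesis using that tR by blast
  next
    case True
    have nzL: "poly [:-a, 1:] z \<noteq> 0" if "cmod z = 1" for z using that True by auto
    have Li: "?L * invf ?L = 1" using nzL by (rule polyf_invf)
    let ?r = "polyf p * invf (polyf (s * [:-a, 1:]))"
    have R: "polyf p' * invf (polyf (s * [:-a, 1:])) \<in> rational_funs" for p'
    proof (rule rational_funsI)
      show "s * [:-a, 1:] \<noteq> 0" using ps(2) by (simp del: mult_pCons_right)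
      show "cmod z < 1" if "poly (s * [:-a, 1:]) z = 0" for z
        using that ps(3)[of z] True by (auto simp del: mult_pCons_right)
    qed
    have "?L * ?r = r * (?L * invf ?L)" by (simp only: ps(1) polyf_simps invf_mult ac_simps)
    then have "?L * ?r = r" using Li by simp
    then have "?L * (u - ?r) \<in> H2" using r(2) by (simp add: right_diff_distrib)
    moreover have "u - ?r \<in> L2" by (intro L2_diff u Linf_imp_L2 rational_funs_Linf R)
    ultimately obtain c where c: "u - ?r - cscale c (invf ?L) \<in> H2"
      using linear_div_inside[of "u - ?r" a] True by blast
    \<comment> \<open>Expanding by s / s puts the pole part over the common denominator s (z - a),
      which turns the numerator into p + c s.\<close>
    have "cscale c (invf ?L) = cscale c (polyf s * invf (polyf s)) * invf ?L"
      using nz by (simp add: polyf_invf cscale_mult_left)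
    then have "?r + cscale c (invf ?L) = polyf (p + smult c s) * invf (polyf (s * [:-a, 1:]))"
      by (simp only: polyf_simps(3,5,6) invf_mult distrib_right cscale_mult_left mult.assoc)
    then show thesis using that[OF R[of "p + smult c s"]] c by (simp add: diff_diff_eq)
  qed
qed

text \<open>Induction on the degree. With q = (z - a) q' the hypothesis is applied to (z - a) u and
  q', and \<open>linear_div_rational\<close> then removes the linear factor; this is why u varies
  along with q.\<close>

lemma Kronecker:
  assumes "q \<noteq> 0" "u \<in> L2" "polyf q * u \<in> H2"
  obtains r where "r \<in> rational_funs" "u - r \<in> H2"
proof -
  have "\<exists>r\<in>rational_funs. u - r \<in> H2"
    using assms
  proof (induction "degree q" arbitrary: q u)
    case 0
    then obtain c where q: "q = [:c:]" "c \<noteq> 0" by (metis degree_eq_zeroE pCons_0_0)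
    then have "cscale c u \<in> H2" using 0 by (simp add: cscale_mult_left)
    then have "u \<in> H2" using q(2) by (rule H2_cscale_cancel)
    then have "u - polyf 0 * invf (polyf 1) \<in> H2" by simp
    moreover have "polyf 0 * invf (polyf 1) \<in> rational_funs" by (intro rational_funsI) auto
    ultimately show ?case by blast
  next
    case (Suc n)
    then obtain a where "poly q a = 0"
      using fundamental_theorem_of_algebra[of q] by (auto simp: constant_degree)
    then obtain q' where q': "q = [:-a, 1:] * q'" unfolding poly_eq_0_iff_dvd by (rule dvdE)
    then have "q' \<noteq> 0" using Suc.prems by auto
    moreover have "n = degree q'" using Suc.hyps(2) \<open>q' \<noteq> 0\<close> unfolding q' by (simp add: degree_mult_eq del: mult_pCons_left)
    moreover have "polyf [:-a, 1:] * u \<in> L2" using Suc.prems by auto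
    moreover have "polyf q' * (polyf [:-a, 1:] * u) \<in> H2"
      using Suc.prems(3) unfolding q' by (simp only: polyf_simps ac_simps)
    ultimately obtain r where "r \<in> rational_funs" "polyf [:-a, 1:] * u - r \<in> H2"
      using Suc.hyps(1) by blast
    then show ?case using linear_div_rational[OF Suc.prems(2)] by blast
  qed
  then show thesis using that by blast
qed

section \<open>Finite Blaschke products\<close>

definition blaschke_factor :: "complex \<Rightarrow> circle_fun" where
  "blaschke_factor a = polyf [:-a, 1:] * invf (polyf [:1, - cnj a:])"

lemma blaschke_denominator_nonzero:
  assumes "cmod a < 1" "cmod z = 1"
  shows "poly [:1, - cnj a:] z \<noteq> 0"
proof
  assume "poly [:1, - cnj a:] z = 0"
  then have "z * cnj a = 1" by simp
  then have "cmod (z * cnj a) = 1" by simp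
  then show False using assms by (simp add: norm_mult)
qed

lemma finite_blaschke_eq: "finite_blaschke \<theta> \<longleftrightarrow> (\<exists>c as. cmod c = 1 \<and> (\<forall>a\<in>set as. cmod a < 1) \<and>
    \<theta> = cscale c (\<Prod>a\<leftarrow>as. blaschke_factor a))"
proof -
  have [measurable]: "(\<lambda>z. \<Prod>a\<leftarrow>as. (z - a) / (1 - cnj a * z)) \<in> borel_measurable borel" for as
    by (induction as) simp_all
  have "abs_circle_fun (\<lambda>z. \<Prod>a\<leftarrow>as. (z - a) / (1 - cnj a * z)) = (\<Prod>a\<leftarrow>as. blaschke_factor a)" for as
  proof (induction as)
    case (Cons a as)
    have "blaschke_factor a = abs_circle_fun (\<lambda>z. (z - a) / (1 - cnj a * z))"
      by (simp add: blaschke_factor_def polyf_abs invf.abs_eq times_circle_fun.abs_eq divide_inverse mult.commute)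
    then show ?case using Cons[symmetric] by (simp add: times_circle_fun.abs_eq)
  qed (simp add: one_circle_fun_def)
  then have "abs_circle_fun (\<lambda>z. c * (\<Prod>a\<leftarrow>as. (z - a) / (1 - cnj a * z)))
      = cscale c (\<Prod>a\<leftarrow>as. blaschke_factor a)" for c as
    by (simp flip: cscale.abs_eq)
  then show ?thesis unfolding finite_blaschke_def by simp
qed

lemma finite_blaschke_mult:
  assumes "finite_blaschke \<theta>" "cmod a < 1"
  shows "finite_blaschke (blaschke_factor a * \<theta>)"
proof -
  obtain c as where "cmod c = 1" "\<forall>a\<in>set as. cmod a < 1" "\<theta> = cscale c (\<Prod>a\<leftarrow>as. blaschke_factor a)"
    using assms(1) unfolding finite_blaschke_eq by blast
  then show ?thesis unfolding finite_blaschke_eq using assms(2)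
    by (intro exI[of _ c] exI[of _ "a # as"]) (simp add: cscale_mult_right)
qed

text \<open>Multiplying by all denominators 1 - conj(a) z leaves a polynomial; these denominators
  have no zero on the circle.\<close>

lemma finite_blaschke_quotient:
  assumes "finite_blaschke \<theta>"
  obtains p q where "\<theta> * polyf q = polyf p" "\<And>z. cmod z = 1 \<Longrightarrow> poly q z \<noteq> 0"
proof -
  obtain c as where as: "\<forall>a\<in>set as. cmod a < 1" "\<theta> = cscale c (\<Prod>a\<leftarrow>as. blaschke_factor a)"
    using assms unfolding finite_blaschke_eq by blast
  have "\<exists>p q. (\<Prod>a\<leftarrow>as. blaschke_factor a) * polyf q = polyf p \<and> (\<forall>z. cmod z = 1 \<longrightarrow> poly q z \<noteq> 0)"
    using as(1)
  proof (induction as)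
    case Nil
    then show ?case by (intro exI[of _ 1]) simp
  next
    case (Cons a as)
    then obtain p q where pq: "(\<Prod>a\<leftarrow>as. blaschke_factor a) * polyf q = polyf p" "\<forall>z. cmod z = 1 \<longrightarrow> poly q z \<noteq> 0"
      by auto
    let ?D = "polyf [:1, - cnj a:]"
    have D: "?D * invf ?D = 1"
      using Cons.prems by (intro polyf_invf blaschke_denominator_nonzero[of a]) auto
    have "(\<Prod>a\<leftarrow>a # as. blaschke_factor a) * polyf ([:1, - cnj a:] * q)
        = polyf [:-a, 1:] * ((\<Prod>a\<leftarrow>as. blaschke_factor a) * polyf q) * (?D * invf ?D)"
      by (simp only: list.map prod_list.Cons blaschke_factor_def polyf_simps(5) ac_simps)
    also have "\<dots> = polyf ([:-a, 1:] * p)" by (simp only: pq D polyf_simps(5) mult_1_right)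
    finally show ?case
      using pq(2) Cons.prems blaschke_denominator_nonzero[of a]
      by (intro exI[of _ "[:-a, 1:] * p"] exI[of _ "[:1, - cnj a:] * q"]) (auto simp del: mult_pCons_left poly_pCons)
  qed
  then obtain p q where "(\<Prod>a\<leftarrow>as. blaschke_factor a) * polyf q = polyf p" "\<And>z. cmod z = 1 \<Longrightarrow> poly q z \<noteq> 0"
    by blast
  then show thesis using that[of q "smult c p"] as(2) by (simp add: cscale_mult_left)
qed

text \<open>Orthogonality of f to theta z^n says that conj(theta) f has coefficient 0 at n, for each
  n >= 0.\<close>

lemma model_space_conj_below:
  assumes "inner_function \<theta>" "f \<in> model_space \<theta>"
  shows "conj_fun \<theta> * f \<in> below 0"
proof -
  have "fourier_coeff (conj_fun \<theta> * f) n = 0" if "n \<ge> 0" for n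
    using model_space_orthogonal(1)[OF assms(2) H2_zpow[OF that]]
    by (simp add: fourier_coeff_eq_cinner cinner_mult_left)
  then show ?thesis
    using assms by (auto simp: below_def intro: theta_mult_L2 dest: model_space_H2)
qed

text \<open>With theta = p/q on the circle, q f equals p conj(theta) f. The first form is in
  \<open>H2\<close> and the second has frequencies below the degree of p, so f is a polynomial of
  bounded degree divided by q.\<close>

lemma finite_blaschke_model_space:
  assumes inner: "inner_function \<theta>" and "finite_blaschke \<theta>"
  obtains B where "finite B" "model_space \<theta> \<subseteq> circle_fun.span B"
proof -
  obtain p q where pq: "\<theta> * polyf q = polyf p" and nz: "\<And>z. cmod z = 1 \<Longrightarrow> poly q z \<noteq> 0"
    using assms(2) by (rule finite_blaschke_quotient) blast
  let ?B = "(\<lambda>k. invf (polyf q) * zpow (int k)) ` {..<degree p}"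
  have "f \<in> circle_fun.span ?B" if f: "f \<in> model_space \<theta>" for f
  proof -
    have "polyf q * f = (\<theta> * polyf q) * (conj_fun \<theta> * f)"
      using inner_function_conj[OF inner] by (metis mult.assoc mult.commute)
    also have "\<dots> = polyf p * (conj_fun \<theta> * f)" unfolding pq ..
    also have "\<dots> \<in> below (0 + int (degree p))" by (intro polyf_mult_below model_space_conj_below inner f)
    finally have "polyf q * f \<in> below (degree p)" by simp
    then have "invf (polyf q) * (polyf q * f) \<in> circle_fun.span ?B"
      using model_space_H2[OF f] by (intro H2_below_span polyf_mult_H2)
    then show ?thesis using nz by simp
  qed
  then show thesis using that[of ?B] by auto
qed

lemma unimodularI: "f * conj_fun f = 1 \<Longrightarrow> unimodular f"
proof -
  assume *: "f * conj_fun f = 1"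
  obtain F where F: "F \<in> borel_measurable borel" "f = abs_circle_fun F" by (rule circle_fun_abs_cases)
  have "abs_circle_fun (\<lambda>x. F x * cnj (F x)) = abs_circle_fun (\<lambda>_. 1)"
    using * F by (simp add: conj_fun.abs_eq times_circle_fun.abs_eq one_circle_fun_def)
  then have "circle_ae_eq (\<lambda>x. F x * cnj (F x)) (\<lambda>_. 1)"
    using F Quotient3_rel[OF Quotient3_circle_fun, of "\<lambda>x. F x * cnj (F x)" "\<lambda>_. 1"] by simp
  then have "AE x in circle_measure. F x * cnj (F x) = 1" by (simp add: circle_ae_eq_def)
  then have "AE x in circle_measure. cmod (F x) = 1"
  proof eventually_elim
    case (elim x)
    then have "(cmod (F x))\<^sup>2 = 1" by (metis cmod_mult_cnj of_real_eq_1_iff of_real_power)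
    then show ?case by (simp add: power2_eq_1_iff) (use norm_ge_zero[of "F x"] in linarith)
  qed
  then show ?thesis using F by (simp add: unimodular.abs_eq)
qed

text \<open>On the circle conj(z) = 1/z. This identity is the reason why Blaschke factors are
  unimodular.\<close>

lemma conj_blaschke_denominator: "conj_fun (polyf [:1, - cnj a:]) = zpow (-1) * polyf [:-a, 1:]"
  by (simp add: polyf_linear polyf_pCons right_diff_distrib zpow_mult cscale_mult_right circle_fun.scale_minus_left)

text \<open>For nonzero a the only root 1 / conj(a) lies outside the disc, which is the harmless
  case of division.\<close>

lemma blaschke_denominator_div:
  assumes a: "cmod a < 1" and v: "v \<in> L2" and H2: "polyf [:1, - cnj a:] * v \<in> H2"
  shows "v \<in> H2"
proof (cases "a = 0")
  case True
  then show ?thesis using H2 by simp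
next
  case False
  have "[:1, - cnj a:] = smult (- cnj a) [:- (1 / cnj a), 1:]" using False by simp
  then have "polyf [:1, - cnj a:] * v = cscale (- cnj a) (polyf [:- (1 / cnj a), 1:] * v)"
    by (simp only: polyf_simps cscale_mult_left)
  then have "cscale (- cnj a) (polyf [:- (1 / cnj a), 1:] * v) \<in> H2" using H2 by simp
  then have "polyf [:- (1 / cnj a), 1:] * v \<in> H2"
    by (rule H2_cscale_cancel) (use False in simp)
  then show ?thesis
    by (rule linear_div_outside[OF v]) (use a False in \<open>simp add: norm_divide\<close>)
qed

text \<open>Each root a of p belongs either to g or to theta. In the first case it is cancelled from
  g; in the second a Blaschke factor is split off theta, leaving an inner function that divides a
  polynomial of lower degree.\<close>

lemma inner_divides_poly:
  assumes "inner_function \<theta>" "p \<noteq> 0" "polyf p = \<theta> * g" "g \<in> H2"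
  shows "finite_blaschke \<theta>"
  using assms
proof (induction "degree p" arbitrary: p \<theta> g)
  case 0
  then obtain c where p: "p = [:c:]" "c \<noteq> 0" by (metis degree_eq_zeroE pCons_0_0)
  have "g = conj_fun \<theta> * polyf p" unfolding 0(4) using inner_function_conj(4)[OF 0(2)] by simp
  then have "cscale c (conj_fun \<theta>) = g" unfolding p by (simp add: cscale_mult_right)
  then have "cscale c (conj_fun \<theta>) \<in> H2" using 0(5) by simp
  \<comment> \<open>An inner function whose conjugate is also in \<open>H2\<close> has only the
    frequency 0, hence is a unimodular constant.\<close>
  then have "conj_fun \<theta> \<in> H2" using p(2) by (rule H2_cscale_cancel)
  then have "conj_fun (conj_fun \<theta>) \<in> below 1" by (rule conj_H2_below)
  then have "\<theta> \<in> below (int 1)" by simp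
  from H2_below_sum[OF inner_function_H2[OF 0(2)] this]
  obtain t where t: "\<theta> = cscale t 1" by auto
  have "cscale (t * cnj t) 1 = 1"
    using inner_function_conj(1)[OF 0(2)] unfolding t by (simp add: cscale_mult_left)
  then have "fourier_coeff (cscale (t * cnj t) 1) 0 = fourier_coeff 1 0" by simp
  then have "(complex_of_real (cmod t))\<^sup>2 = 1" by (simp add: cmod_mult_cnj)
  then have "cmod t = 1"
    by (metis norm_ge_zero norm_of_real norm_one norm_power abs_norm_cancel power2_eq_1_iff abs_1 abs_minus_cancel)
  then show ?case unfolding finite_blaschke_eq by (intro exI[of _ t] exI[of _ "[]"]) (simp add: t)
next
  case (Suc n)
  note inner = Suc.prems(1)
  obtain a where "poly p a = 0"
    using fundamental_theorem_of_algebra[of p] Suc.hyps(2) by (auto simp: constant_degree)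
  then obtain p1 where p1: "p = [:-a, 1:] * p1" unfolding poly_eq_0_iff_dvd by (rule dvdE)
  have p1_nz: "p1 \<noteq> 0" using Suc.prems p1 by auto
  have deg: "n = degree p1" using Suc.hyps(2) p1_nz unfolding p1 by (simp add: degree_mult_eq del: mult_pCons_left)
  let ?L = "polyf [:-a, 1:]" and ?D = "polyf [:1, - cnj a:]"
  \<comment> \<open>This is g / (z - a); whether it stays in \<open>H2\<close> decides to which
    factor the root belongs.\<close>
  define v where "v = conj_fun \<theta> * polyf p1"
  have vL: "v \<in> L2" unfolding v_def using inner by (intro theta_mult_L2 Linf_imp_L2) auto
  have p1v: "polyf p1 = \<theta> * v" unfolding v_def using inner by (simp add: inner_function_conj)
  have "?L * v = conj_fun \<theta> * polyf p" unfolding p1 v_def by (simp only: polyf_simps(5) ac_simps)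
  also have "\<dots> = g" unfolding Suc.prems(3) using inner by (simp add: inner_function_conj)
  finally have Lv: "?L * v \<in> H2" using Suc.prems by simp
  show ?case
  proof (cases "v \<in> H2")
    case True
    then show ?thesis using Suc.hyps(1)[OF deg inner p1_nz p1v] by simp
  next
    case False
    then have a: "cmod a < 1" using linear_div_outside[OF vL Lv] by linarith
    then obtain c where c: "v - cscale c (invf ?L) \<in> H2" using linear_div_inside[OF vL Lv] by blast
    then have c0: "c \<noteq> 0" using False by auto
    have nzL: "poly [:-a, 1:] z \<noteq> 0" if "cmod z = 1" for z using that a by auto
    have L: "?L * invf ?L = 1" using nzL by (rule polyf_invf)
    have D: "?D * invf ?D = 1" using blaschke_denominator_nonzero[OF a] by (rule polyf_invf)
    have "\<theta> * cscale c (invf ?L) = polyf p1 - \<theta> * (v - cscale c (invf ?L))"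
      by (simp add: p1v right_diff_distrib)
    then have "\<theta> * cscale c (invf ?L) \<in> H2" using c inner by (auto intro: theta_mult_H2)
    then have "cscale (1 / c) (\<theta> * cscale c (invf ?L)) \<in> H2" by (rule H2_cscale)
    \<comment> \<open>In substance theta vanishes at a: since c is nonzero, the pole part of v must
      be cancelled by theta in the polynomial p1.\<close>
    then have H2: "\<theta> * invf ?L \<in> H2" using c0 by (simp add: cscale_mult_right)
    \<comment> \<open>The quotient of theta by the Blaschke factor at a.\<close>
    define \<theta>' where "\<theta>' = ?D * (\<theta> * invf ?L)"
    have inner': "inner_function \<theta>'"
      unfolding inner_function_def Hinf_def
    proof (intro conjI IntI)
      show "\<theta>' \<in> H2" unfolding \<theta>'_def using H2 by (rule polyf_mult_H2)
      show "\<theta>' \<in> Linf" unfolding \<theta>'_def using nzL inner by (intro Linf_mult) (auto intro: inner_function_Linf)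
      have "\<theta>' * conj_fun \<theta>' = (\<theta> * conj_fun \<theta>) * (?L * invf ?L) * ((zpow (-1) * ?D) * conj_fun (invf ?L))"
        unfolding \<theta>'_def by (simp only: conj_fun_simps conj_blaschke_denominator ac_simps)
      also have "zpow (-1) * ?D = conj_fun ?L"
        by (simp add: polyf_linear polyf_pCons right_diff_distrib zpow_mult cscale_mult_right circle_fun.scale_minus_left)
      also have "conj_fun ?L * conj_fun (invf ?L) = 1"
        unfolding conj_fun_simps(3)[symmetric] L by simp
      finally show "unimodular \<theta>'"
        using L inner by (intro unimodularI) (simp add: inner_function_conj)
    qed
    have "blaschke_factor a * \<theta>' = \<theta> * (?L * invf ?L) * (?D * invf ?D)"
      unfolding \<theta>'_def blaschke_factor_def by (simp only: ac_simps)
    then have \<theta>: "\<theta> = blaschke_factor a * \<theta>'" using L D by simp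
    have "\<theta>' * (invf ?D * g) = (\<theta> * g) * invf ?L * (?D * invf ?D)"
      unfolding \<theta>'_def by (simp only: ac_simps)
    also have "\<dots> = polyf p1 * (?L * invf ?L) * (?D * invf ?D)"
      unfolding Suc.prems(3)[symmetric] p1 by (simp only: polyf_simps(5) ac_simps)
    finally have p1': "polyf p1 = \<theta>' * (invf ?D * g)" using L D by simp
    have "invf ?D * g \<in> H2"
    proof (rule blaschke_denominator_div[OF a])
      show "invf ?D * g \<in> L2"
        using Suc.prems(4) blaschke_denominator_nonzero[OF a] by (intro L2_Linf_mult invf_polyf_Linf) auto
      show "?D * (invf ?D * g) \<in> H2" using Suc.prems(4) D by (simp flip: mult.assoc)
    qed
    then have "finite_blaschke \<theta>'" using Suc.hyps(1)[OF deg inner' p1_nz p1'] by simp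
    then show ?thesis unfolding \<theta> using a by (rule finite_blaschke_mult)
  qed
qed

section \<open>Finite rank truncated Toeplitz operators\<close>

text \<open>Multiplication by z moves only the coefficient at -1 out of the negative frequencies;
  this is the source of the defect in \<open>model_proj_shift\<close>.\<close>

lemma zpow_mult_below_0:
  assumes "u \<in> below 0"
  shows "zpow 1 * u - cscale (fourier_coeff u (-1)) 1 \<in> below 0"
proof -
  have "u \<in> L2" using assms by (rule below_L2)
  then have L2: "zpow 1 * u \<in> L2" "cscale (fourier_coeff u (-1)) 1 \<in> L2" by auto
  then have "fourier_coeff (zpow 1 * u - cscale (fourier_coeff u (-1)) 1) n = 0" if "n \<ge> 0" for n
    using assms that by (cases "n = 0") (simp_all add: below_def)
  then show ?thesis using L2 by (auto simp: below_def)
qed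

lemma polyf_sum:
  assumes "degree p \<le> N"
  shows "polyf p = (\<Sum>k\<le>N. cscale (coeff p k) (zpow (int k)))"
proof -
  have monom: "polyf (monom c k) = cscale c (zpow (int k))" for c k
    by (induction k) (simp_all add: monom_0 monom_Suc polyf_pCons cscale_mult_right zpow_mult add.commute)
  have sum: "polyf (\<Sum>k\<in>A. f k) = (\<Sum>k\<in>A. polyf (f k))" if "finite A" for f :: "nat \<Rightarrow> complex poly" and A
    using that by (induction A) simp_all
  have "polyf p = polyf (\<Sum>k\<le>N. monom (coeff p k) k)"
    by (simp add: poly_as_sum_of_monoms'[OF assms])
  then show ?thesis by (simp add: sum monom)
qed

text \<open>The relation concerns a sequence and not a set, so repeated values are handled
  separately. Its coefficients are stored in a polynomial because applying the relation to powers of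
  z then produces \<open>polyf p\<close>.\<close>

lemma dependent_sequence:
  assumes "finite B" "\<And>k. x k \<in> circle_fun.span B"
  obtains p N where "p \<noteq> 0" "degree p \<le> N" "(\<Sum>k\<le>N. cscale (coeff p k) (x k)) = 0"
proof (cases "inj_on x {..card B}")
  case False
  then obtain i j where ij: "i \<noteq> j" "x i = x j" by (auto simp: inj_on_def)
  \<comment> \<open>A repetition is itself a relation.\<close>
  let ?p = "monom 1 i - monom 1 j :: complex poly"
  let ?N = "max i j"
  show thesis
  proof (rule that[of ?p ?N])
    have "coeff ?p i = 1" using ij by simp
    then show "?p \<noteq> 0" by (metis coeff_0 zero_neq_one)
    show "degree ?p \<le> ?N" by (intro degree_diff_le) (auto intro: order_trans[OF degree_monom_le])
    have "(\<Sum>k\<le>?N. cscale (coeff ?p k) (x k))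
        = (\<Sum>k\<le>?N. (if k = i then x i else 0) - (if k = j then x j else 0))"
      by (intro sum.cong refl) (auto simp: circle_fun.scale_left_diff_distrib)
    also have "\<dots> = x i - x j" by (simp add: sum_subtractf)
    finally show "(\<Sum>k\<le>?N. cscale (coeff ?p k) (x k)) = 0" using ij by simp
  qed
next
  case True
  let ?N = "card B"
  let ?S = "x ` {..?N}"
  have card: "card ?S = Suc (card B)" using True by (simp add: card_image)
  have "?S \<subseteq> circle_fun.span B" using assms(2) by auto
  then have "circle_fun.dependent ?S"
    using circle_fun.independent_span_bound[OF assms(1), of ?S] card by auto
  then obtain u v where u: "v \<in> ?S" "u v \<noteq> 0" "(\<Sum>v\<in>?S. cscale (u v) v) = 0"
    by (subst (asm) circle_fun.dependent_finite) auto
  \<comment> \<open>Dependence is expressed by weights on vectors; injectivity of x allows them to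
    be read as weights on indices.\<close>
  let ?p = "\<Sum>k\<le>?N. monom (u (x k)) k"
  have c: "coeff ?p k = (if k \<le> ?N then u (x k) else 0)" for k
    by (simp add: coeff_sum)
  obtain i where i: "i \<le> ?N" "v = x i" using u(1) by auto
  show thesis
  proof (rule that[of ?p ?N])
    have "coeff ?p i \<noteq> 0" using i u(2) by (simp add: c)
    then show "?p \<noteq> 0" by (metis coeff_0)
    show "degree ?p \<le> ?N" by (rule degree_le) (simp add: c)
    have "(\<Sum>k\<le>?N. cscale (coeff ?p k) (x k)) = (\<Sum>k\<le>?N. cscale (u (x k)) (x k))"
      by (intro sum.cong refl) (simp add: c)
    also have "\<dots> = 0" using u(3) by (simp add: sum.reindex[OF True])
    finally show "(\<Sum>k\<le>?N. cscale (coeff ?p k) (x k)) = 0" .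
  qed
qed

lemma Hinf_plus_rationalI:
  assumes "f \<in> Linf" "r \<in> rational_funs" "f - r \<in> H2"
  shows "f \<in> Hinf + rational_funs"
proof -
  have "f - r \<in> Hinf" using assms by (auto simp: Hinf_def intro: rational_funs_Linf)
  then have "(f - r) + r \<in> Hinf + rational_funs" using assms(2) by (rule set_plus_intro)
  then show ?thesis by simp
qed

section \<open>Rank of the compression with bounded symbol\<close>

context
  fixes \<theta> \<psi>
  assumes inner: "inner_function \<theta>" and psi: "\<psi> \<in> Linf"
begin

abbreviation (input) toep where "toep g \<equiv> orth_proj (model_space \<theta>) (\<psi> * g)"

lemma psi_L2: "g \<in> H2 \<Longrightarrow> \<psi> * g \<in> L2"
  using psi by auto

lemma toep_add: "f \<in> H2 \<Longrightarrow> g \<in> H2 \<Longrightarrow> toep (f + g) = toep f + toep g"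
  using inner by (simp add: distrib_left model_proj_add psi_L2)

lemma toep_cscale: "f \<in> H2 \<Longrightarrow> toep (cscale c f) = cscale c (toep f)"
  using inner by (simp add: cscale_mult_right model_proj_cscale psi_L2)

lemma toep_subspace: "circle_fun.subspace (toep ` H2)"
proof (rule circle_fun.subspaceI)
  show "0 \<in> toep ` H2" using model_proj_below[OF inner, of 0] by (auto intro!: image_eqI[of _ _ 0])
  show "x + y \<in> toep ` H2" if "x \<in> toep ` H2" "y \<in> toep ` H2" for x y
    using that by (auto simp flip: toep_add)
  show "cscale c x \<in> toep ` H2" if "x \<in> toep ` H2" for c x
    using that by (auto simp flip: toep_cscale)
qed

lemma toep_zpow_in: "g \<in> H2 \<Longrightarrow> toep (zpow 1 * g) \<in> toep ` H2"
  by (rule image_eqI[OF refl]) auto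

lemma toep_polyf: "degree p \<le> N \<Longrightarrow> g \<in> H2 \<Longrightarrow> toep (polyf p * g) = (\<Sum>k\<le>N. cscale (coeff p k) (toep (zpow (int k) * g)))"
proof -
  assume p: "degree p \<le> N" and g: "g \<in> H2"
  have "\<psi> * (polyf p * g) = (\<Sum>k\<le>N. cscale (coeff p k) (\<psi> * (zpow (int k) * g)))"
    unfolding polyf_sum[OF p] sum_distrib_right sum_distrib_left
    by (simp add: cscale_mult_right cscale_mult_left)
  moreover have "\<psi> * (zpow (int k) * g) \<in> L2" for k using g by (intro psi_L2 H2_zpow_mult) auto
  ultimately show ?thesis using inner by (simp add: model_proj_sum model_proj_cscale L2_cscale)
qed

text \<open>Writing psi g = theta (w + r) g, the projection removes everything except theta times
  the negative part of r g, and by \<open>rational_mult_H2\<close> that part lies in a fixed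
  finite-dimensional space.\<close>

lemma finite_rank_if_rational:
  assumes "conj_fun \<theta> * \<psi> \<in> Hinf + rational_funs"
  obtains B where "finite B" "toep ` H2 \<subseteq> circle_fun.span B"
proof -
  obtain w r where w: "conj_fun \<theta> * \<psi> = w + r" "w \<in> Hinf" "r \<in> rational_funs"
    using assms by (rule set_plus_elim)
  obtain p q where r: "r = polyf p * invf (polyf q)" and nz: "\<And>z. cmod z = 1 \<Longrightarrow> poly q z \<noteq> 0"
    using w(3) by (rule rational_funsE) blast
  define S where "S = (\<lambda>k. invf (polyf q) * zpow (int k)) ` {..<degree q}"
  have S: "s \<in> L2" if "s \<in> S" for s
    using that nz unfolding S_def by (auto intro!: L2_Linf_mult invf_polyf_Linf)
  let ?P = "\<lambda>v. orth_proj (model_space \<theta>) (\<theta> * v)"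
  \<comment> \<open>Membership in \<open>L2\<close> is carried through the induction because the
    projection is known to be linear only there.\<close>
  have span: "v \<in> L2 \<and> ?P v \<in> circle_fun.span (?P ` S)" if "v \<in> circle_fun.span S" for v
    using that
  proof (induction rule: circle_fun.span_induct_alt)
    case base
    then show ?case using model_proj_below[OF inner, of 0] by (simp add: circle_fun.span_zero)
  next
    case (step c x y)
    have x: "cscale c x \<in> L2" "\<theta> * x \<in> L2" "\<theta> * y \<in> L2" "\<theta> * cscale c x \<in> L2"
      using S[OF step(1)] step(2) inner by (auto intro!: theta_mult_L2)
    have "?P (cscale c x + y) = cscale c (?P x) + ?P y"
      using x inner by (simp add: distrib_left model_proj_add) (simp add: cscale_mult_right model_proj_cscale)
    moreover have "?P x \<in> circle_fun.span (?P ` S)" using step(1) by (intro circle_fun.span_base) auto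
    ultimately have "?P (cscale c x + y) \<in> circle_fun.span (?P ` S)"
      using step(2) by (auto intro: circle_fun.span_add circle_fun.span_scale)
    then show ?case using step(2) x(1) by auto
  qed
  have "toep g \<in> circle_fun.span (?P ` S)" if g: "g \<in> H2" for g
  proof -
    obtain h v where hv: "r * g = h + v" "h \<in> H2" "v \<in> circle_fun.span S"
      unfolding r S_def by (rule rational_mult_H2[OF nz g])
    have "\<psi> = \<theta> * (conj_fun \<theta> * \<psi>)" using inner by (simp add: inner_function_conj)
    then have "\<psi> * g = \<theta> * ((w + r) * g)" unfolding w(1) by (metis mult.assoc)
    also have "\<dots> = \<theta> * (w * g + h) + \<theta> * v" using hv(1) by (simp add: algebra_simps)
    finally have eq: "\<psi> * g = \<theta> * (w * g + h) + \<theta> * v" .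
    have H2: "w * g + h \<in> H2" using w(2) g hv(2) by (intro H2_add Hinf_mult_H2)
    have "\<theta> * (w * g + h) \<in> L2" "\<theta> * v \<in> L2"
      using theta_mult_H2[OF inner H2] theta_mult_L2(1)[OF inner] span[OF hv(3)] by auto
    then have "toep g = ?P v" unfolding eq using H2 inner by (simp add: model_proj_add model_proj_theta)
    then show ?thesis using span[OF hv(3)] by simp
  qed
  then show thesis using that[of "?P ` S"] by (auto simp: S_def)
qed

text \<open>The argument is z times a general element of the kernel of the projection. Only the
  coefficient that reaches frequency 0 survives, as all other terms stay in \<open>below 0\<close>
  or in theta \<open>H2\<close>.\<close>

lemma model_proj_shift:
  assumes "u \<in> below 0" "v \<in> H2"
  shows "orth_proj (model_space \<theta>) (zpow 1 * (u + \<theta> * v))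
      = cscale (fourier_coeff u (-1)) (orth_proj (model_space \<theta>) 1)"
proof -
  let ?c = "fourier_coeff u (-1)" and ?u = "zpow 1 * u - cscale (fourier_coeff u (-1)) 1"
  have u: "?u \<in> below 0" using assms(1) by (rule zpow_mult_below_0)
  have v: "zpow 1 * v \<in> H2" using assms(2) by auto
  have eq: "zpow 1 * (u + \<theta> * v) = cscale ?c 1 + (?u + \<theta> * (zpow 1 * v))"
    by (simp add: algebra_simps)
  have L2: "?u \<in> L2" "\<theta> * (zpow 1 * v) \<in> L2" "cscale ?c 1 \<in> L2" "?u + \<theta> * (zpow 1 * v) \<in> L2"
    using u theta_mult_H2[OF inner v] by (auto intro: below_L2)
  have "orth_proj (model_space \<theta>) (?u + \<theta> * (zpow 1 * v)) = 0"
    using L2 u v inner by (simp only: model_proj_add model_proj_below model_proj_theta add_0_left)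
  then show ?thesis unfolding eq using L2 inner by (simp only: model_proj_add model_proj_cscale L2_one add_0_right)
qed

text \<open>Hence the defect coefficient of u + theta v can be read off the whole function.\<close>

lemma theta_coeff: "v \<in> H2 \<Longrightarrow> fourier_coeff (\<theta> * v) (-1) = 0"
  using theta_mult_H2[OF inner] by (auto simp: H2_def)

lemma finite_rank_only_if:
  assumes B: "finite B" "toep ` H2 \<subseteq> circle_fun.span B"
  shows "conj_fun \<theta> * \<psi> \<in> Hinf + rational_funs \<or> finite_blaschke \<theta>"
proof (cases "\<exists>g\<in>H2. toep g = 0 \<and> fourier_coeff (\<psi> * g) (-1) \<noteq> 0")
  case True
  then obtain g where g: "g \<in> H2" "toep g = 0" "fourier_coeff (\<psi> * g) (-1) \<noteq> 0" by blast
  let ?P = "orth_proj (model_space \<theta>)"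
  obtain u v where uv: "\<psi> * g = u + \<theta> * v" "u \<in> below 0" "v \<in> H2"
    using model_proj_eq_0[OF inner psi_L2[OF g(1)] g(2)] by blast
  have L2: "u \<in> L2" "\<theta> * v \<in> L2" using uv theta_mult_H2[OF inner uv(3)] by auto
  have c: "fourier_coeff u (-1) \<noteq> 0" using g(3) theta_coeff[OF uv(3)] L2 unfolding uv(1) by simp
  have "toep (zpow 1 * g) = cscale (fourier_coeff u (-1)) (?P 1)"
    unfolding mult.left_commute[of \<psi> "zpow 1"] uv(1) by (rule model_proj_shift[OF uv(2,3)])
  then have "?P 1 = cscale (1 / fourier_coeff u (-1)) (toep (zpow 1 * g))" using c by simp
  moreover have "toep (zpow 1 * g) \<in> toep ` H2" using g(1) by (rule toep_zpow_in)
  ultimately have P1: "?P 1 \<in> toep ` H2" using circle_fun.subspace_scale[OF toep_subspace] by metis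
  have "?P (zpow (int n)) \<in> toep ` H2" for n
  proof (induction n)
    case 0
    then show ?case using P1 by simp
  next
    case (Suc n)
    then obtain g' where g': "g' \<in> H2" "?P (zpow (int n)) = toep g'" by auto
    \<comment> \<open>This difference is in the kernel of the projection, so multiplying it by z
      costs a multiple of P 1 only, which is already known to be in the range.\<close>
    have L: "\<psi> * g' - zpow (int n) \<in> L2" using psi_L2[OF g'(1)] by auto
    have "?P (\<psi> * g' - zpow (int n)) + ?P (zpow (int n)) = toep g'"
      using L inner model_proj_add[OF inner L, of "zpow (int n)"] by simp
    then have "?P (\<psi> * g' - zpow (int n)) = 0" using g'(2) by simp
    then obtain u v where uv: "\<psi> * g' - zpow (int n) = u + \<theta> * v" "u \<in> below 0" "v \<in> H2"
      using model_proj_eq_0[OF inner L] by blast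
    have "zpow 1 * (\<psi> * g' - zpow (int n)) \<in> L2" using L by (intro L2_Linf_mult) auto
    moreover have "\<psi> * (zpow 1 * g') = zpow (int (Suc n)) + zpow 1 * (\<psi> * g' - zpow (int n))"
      by (simp add: right_diff_distrib zpow_mult mult.left_commute)
    ultimately have "toep (zpow 1 * g') = ?P (zpow (int (Suc n))) + ?P (zpow 1 * (\<psi> * g' - zpow (int n)))"
      using inner by (simp only: model_proj_add zpow_L2)
    then have "toep (zpow 1 * g') = ?P (zpow (int (Suc n))) + cscale (fourier_coeff u (-1)) (?P 1)"
      unfolding uv(1) model_proj_shift[OF uv(2,3)] .
    then have "?P (zpow (int (Suc n))) = toep (zpow 1 * g') - cscale (fourier_coeff u (-1)) (?P 1)" by simp
    also have "\<dots> \<in> toep ` H2"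
      using g'(1) P1
      by (intro circle_fun.subspace_diff[OF toep_subspace] circle_fun.subspace_scale[OF toep_subspace] toep_zpow_in)
    finally show ?case .
  qed
  then have "?P (zpow (int n)) \<in> circle_fun.span B" for n using B(2) by blast
  then obtain p N where p: "p \<noteq> 0" "degree p \<le> N" "(\<Sum>k\<le>N. cscale (coeff p k) (?P (zpow (int k)))) = 0"
    by (rule dependent_sequence[OF B(1), of "\<lambda>k. ?P (zpow (int k))"])
  have "?P (polyf p) = 0"
    unfolding polyf_sum[OF p(2)] using p(3) inner by (simp add: model_proj_sum model_proj_cscale L2_cscale)
  then obtain u v where uv: "polyf p = u + \<theta> * v" "u \<in> below 0" "v \<in> H2"
    using model_proj_eq_0[OF inner, of "polyf p"] by (blast intro: Linf_imp_L2 polyf_Linf)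
  \<comment> \<open>The negative part of a polynomial minus theta v is zero, so theta divides p
    within \<open>H2\<close>.\<close>
  have "u = polyf p - \<theta> * v" using uv(1) by simp
  then have "u \<in> H2" using theta_mult_H2[OF inner uv(3)] by (simp add: H2_diff)
  then have "u = 0" using uv(2) by (rule H2_below_trivial)
  then have "polyf p = \<theta> * v" using uv(1) by simp
  then have "finite_blaschke \<theta>" using inner_divides_poly[OF inner p(1)] uv(3) by blast
  then show ?thesis ..
next
  case False
  \<comment> \<open>The defect vanishes on the whole kernel, so the kernel is shift invariant and
    contains all z^k p once it contains p.\<close>
  then have ker: "fourier_coeff (\<psi> * g) (-1) = 0" if "g \<in> H2" "toep g = 0" for g using that by blast
  have "toep (zpow (int k)) \<in> circle_fun.span B" for k using B(2) by auto
  then obtain p N where p: "p \<noteq> 0" "degree p \<le> N" "(\<Sum>k\<le>N. cscale (coeff p k) (toep (zpow (int k)))) = 0"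
    by (rule dependent_sequence[OF B(1), of "\<lambda>k. toep (zpow (int k))"])
  have T0: "toep (polyf p) = 0" using toep_polyf[OF p(2) H2_one] p(3) by simp
  have Tk: "toep (zpow (int k) * polyf p) = 0" for k
  proof (induction k)
    case 0
    then show ?case using T0 by simp
  next
    case (Suc k)
    let ?g = "zpow (int k) * polyf p"
    have g: "?g \<in> H2" by (intro H2_zpow_mult) auto
    obtain u v where uv: "\<psi> * ?g = u + \<theta> * v" "u \<in> below 0" "v \<in> H2"
      using model_proj_eq_0[OF inner psi_L2[OF g] Suc] by blast
    have L2: "u \<in> L2" "\<theta> * v \<in> L2" using uv theta_mult_H2[OF inner uv(3)] by auto
    have "fourier_coeff u (-1) = 0"
      using ker[OF g Suc] theta_coeff[OF uv(3)] L2 unfolding uv(1) by simp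
    moreover have "zpow (int (Suc k)) * polyf p = zpow 1 * ?g"
      by (simp add: zpow_mult flip: mult.assoc)
    moreover have "toep (zpow 1 * ?g) = cscale (fourier_coeff u (-1)) (orth_proj (model_space \<theta>) 1)"
      unfolding mult.left_commute[of \<psi> "zpow 1"] uv(1) by (rule model_proj_shift[OF uv(2,3)])
    ultimately show ?case by simp
  qed
  \<comment> \<open>This coefficient equals the one of psi z^k p at -1.\<close>
  have "fourier_coeff (\<psi> * polyf p) (-1 - int k) = 0" for k
  proof -
    have "zpow (int k) * polyf p \<in> H2" by (intro H2_zpow_mult) auto
    then have "fourier_coeff (zpow (int k) * (\<psi> * polyf p)) (-1) = 0"
      using ker[OF _ Tk] by (simp add: mult.left_commute)
    then show ?thesis by simp
  qed
  then have H2: "\<psi> * polyf p \<in> H2" by (rule H2_neg_coeffI[OF psi_L2[OF polyf_H2]])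
  obtain u v where uv: "\<psi> * polyf p = u + \<theta> * v" "u \<in> below 0" "v \<in> H2"
    using model_proj_eq_0[OF inner psi_L2 T0] by blast
  have "u = \<psi> * polyf p - \<theta> * v" using uv(1) by simp
  then have "u \<in> H2" using H2 theta_mult_H2[OF inner uv(3)] by (simp add: H2_diff)
  then have "u = 0" using uv(2) by (rule H2_below_trivial)
  then have "conj_fun \<theta> * (\<psi> * polyf p) = v" using uv(1) inner by (simp add: inner_function_conj)
  then have "polyf p * (conj_fun \<theta> * \<psi>) \<in> H2" using uv(3) by (simp add: ac_simps)
  moreover have Linf: "conj_fun \<theta> * \<psi> \<in> Linf" using inner psi by (auto intro: inner_function_Linf)
  ultimately obtain r where "r \<in> rational_funs" "conj_fun \<theta> * \<psi> - r \<in> H2"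
    using Kronecker[OF p(1)] Linf_imp_L2 by blast
  then show ?thesis using Linf by (blast intro: Hinf_plus_rationalI)
qed

lemma finite_rank_iff:
  "(\<exists>B. finite B \<and> toep ` H2 \<subseteq> circle_fun.span B) \<longleftrightarrow>
    conj_fun \<theta> * \<psi> \<in> Hinf + rational_funs \<or> finite_blaschke \<theta>"
proof
  assume "conj_fun \<theta> * \<psi> \<in> Hinf + rational_funs \<or> finite_blaschke \<theta>"
  then show "\<exists>B. finite B \<and> toep ` H2 \<subseteq> circle_fun.span B"
  proof
    assume "finite_blaschke \<theta>"
    then obtain B where B: "finite B" "model_space \<theta> \<subseteq> circle_fun.span B"
      using finite_blaschke_model_space[OF inner] by blast
    have "toep ` H2 \<subseteq> model_space \<theta>" using inner psi_L2 by (auto intro: model_proj_in)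
    then show ?thesis using B by blast
  next
    assume "conj_fun \<theta> * \<psi> \<in> Hinf + rational_funs"
    then obtain B where "finite B" "toep ` H2 \<subseteq> circle_fun.span B" by (rule finite_rank_if_rational)
    then show ?thesis by blast
  qed
next
  assume "\<exists>B. finite B \<and> toep ` H2 \<subseteq> circle_fun.span B"
  then obtain B where "finite B" "toep ` H2 \<subseteq> circle_fun.span B" by blast
  then show "conj_fun \<theta> * \<psi> \<in> Hinf + rational_funs \<or> finite_blaschke \<theta>"
    by (rule finite_rank_only_if)
qed

end

text \<open>\<open>finite_rank_on\<close> demands equality with a span. For a subspace containment
  suffices, because a basis chosen inside it is finite and spans exactly the subspace.\<close>

lemma finite_rank_on_iff:
  assumes "circle_fun.subspace (A ` S)"
  shows "finite_rank_on S A \<longleftrightarrow> (\<exists>B. finite B \<and> A ` S \<subseteq> circle_fun.span B)"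
proof
  assume "\<exists>B. finite B \<and> A ` S \<subseteq> circle_fun.span B"
  then obtain B where B: "finite B" "A ` S \<subseteq> circle_fun.span B" by blast
  obtain C where C: "C \<subseteq> A ` S" "circle_fun.independent C" "A ` S \<subseteq> circle_fun.span C"
    by (rule circle_fun.basis_exists)
  have "finite C" using circle_fun.independent_span_bound[OF B(1) C(2)] C(1) B(2) by auto
  moreover have "circle_fun.span C = A ` S"
    using C(1,3) assms by (intro antisym circle_fun.span_minimal)
  ultimately show "finite_rank_on S A" unfolding finite_rank_on_def by blast
qed (auto simp: finite_rank_on_def)

section \<open>Reduction of Hankel to Toeplitz operators\<close>

lemma AE_circle_unit: "AE x in circle_measure. x * cnj x = 1"
  using AE_circle_norm by eventually_elim (simp add: cmod_mult_cnj)

lemma integral_circle_cnj: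
  fixes f :: "complex \<Rightarrow> 'b :: {banach, second_countable_topology}"
  assumes "f \<in> borel_measurable borel"
  shows "(LINT x|circle_measure. f (cnj x)) = (LINT x|circle_measure. f x)"
proof -
  have "cnj \<in> measurable circle_measure borel" by (simp add: borel_measurable_circle)
  then have "integral\<^sup>L (distr circle_measure borel cnj) f = (LINT x|circle_measure. f (cnj x))"
    using assms by (rule integral_distr)
  then show ?thesis by (simp add: distr_circle_measure_cnj)
qed

lemma integrable_circle_cnj:
  fixes f :: "complex \<Rightarrow> 'b :: {banach, second_countable_topology}"
  assumes "integrable circle_measure f"
  shows "integrable circle_measure (\<lambda>x. f (cnj x))"
proof -
  have "cnj \<in> measurable circle_measure borel" by (simp add: borel_measurable_circle)
  moreover have "integrable (distr circle_measure borel cnj) f"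
    using assms by (simp add: distr_circle_measure_cnj)
  ultimately show ?thesis by (rule integrable_distr)
qed

text \<open>The product of two flips contains conj(z) twice; the factor z compensates for one of
  them.\<close>

lemma flip_mult: "flip (f * g) = zpow 1 * (flip f * flip g)"
proof -
  obtain F where F [measurable]: "F \<in> borel_measurable borel" "f = abs_circle_fun F"
    by (rule circle_fun_abs_cases)
  obtain G where G [measurable]: "G \<in> borel_measurable borel" "g = abs_circle_fun G"
    by (rule circle_fun_abs_cases)
  have "AE x in circle_measure. cnj x * (F (cnj x) * G (cnj x)) =
      x * (cnj x * F (cnj x) * (cnj x * G (cnj x)))"
    using AE_circle_unit
  proof eventually_elim
    case (elim x)
    have "x * (cnj x * F (cnj x) * (cnj x * G (cnj x))) = (x * cnj x) * (cnj x * (F (cnj x) * G (cnj x)))"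
      by (simp only: ac_simps)
    then show ?case using elim by simp
  qed
  then have "circle_ae_eq (\<lambda>x. cnj x * (F (cnj x) * G (cnj x)))
      (\<lambda>x. x * (cnj x * F (cnj x) * (cnj x * G (cnj x))))"
    by (simp add: circle_ae_eq_def borel_measurable_circle)
  from Quotient3_rel_abs[OF Quotient3_circle_fun, OF this] show ?thesis
    using F G by (simp add: times_circle_fun.abs_eq flip.abs_eq zpow.abs_eq)
qed

lemma flip_add: "flip (f + g) = flip f + flip g"
  and flip_cscale: "flip (cscale c f) = cscale c (flip f)"
  by (transfer; simp add: algebra_simps)+

lemma flip_Linf: "f \<in> Linf \<Longrightarrow> flip f \<in> Linf"
proof -
  assume "f \<in> Linf"
  obtain F where F [measurable]: "F \<in> borel_measurable borel" "f = abs_circle_fun F"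
    by (rule circle_fun_abs_cases)
  then obtain C where "AE x in circle_measure. cmod (F x) \<le> C"
    using \<open>f \<in> Linf\<close> by (auto simp: Linf_def essentially_bounded.abs_eq)
  then have "AE x in circle_measure. cmod (F (cnj x)) \<le> C" by (rule AE_circle_measure_cnj)
  then have "AE x in circle_measure. cmod (cnj x * F (cnj x)) \<le> C"
    using AE_circle_norm by eventually_elim (simp add: norm_mult)
  then show ?thesis
    using F by (auto simp: Linf_def flip.abs_eq essentially_bounded.abs_eq)
qed

lemma flip_L2: "f \<in> L2 \<Longrightarrow> flip f \<in> L2"
proof -
  assume "f \<in> L2"
  obtain F where F [measurable]: "F \<in> borel_measurable borel" "f = abs_circle_fun F"
    by (rule circle_fun_abs_cases)
  then have "integrable circle_measure (\<lambda>x. (cmod (F (cnj x)))\<^sup>2)"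
    using \<open>f \<in> L2\<close> integrable_circle_cnj[of "\<lambda>x. (cmod (F x))\<^sup>2"] by (simp add: L2_abs)
  moreover have "AE x in circle_measure. (cmod (F (cnj x)))\<^sup>2 = (cmod (cnj x * F (cnj x)))\<^sup>2"
    using AE_circle_norm by eventually_elim (simp add: norm_mult)
  moreover have "(\<lambda>x. (cmod (cnj x * F (cnj x)))\<^sup>2) \<in> borel_measurable circle_measure"
    unfolding borel_measurable_circle by measurable
  ultimately have "integrable circle_measure (\<lambda>x. (cmod (cnj x * F (cnj x)))\<^sup>2)"
    using integrable_cong_AE_imp by blast
  then show ?thesis using F by (simp add: flip.abs_eq L2_abs)
qed

text \<open>Substituting conj(x) reverses the frequency, and the factor conj(x) of the flip shifts
  it by one, so that n >= 0 corresponds exactly to negative frequencies.\<close>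

lemma fourier_coeff_flip: "fourier_coeff (flip f) n = fourier_coeff f (- n - 1)"
proof -
  obtain F where F [measurable]: "F \<in> borel_measurable borel" "f = abs_circle_fun F"
    by (rule circle_fun_abs_cases)
  have "fourier_coeff (flip f) n = (LINT x|circle_measure. cnj x * F (cnj x) * x powi (- n))"
    using F by (simp add: flip.abs_eq fourier_coeff.abs_eq)
  also have "\<dots> = (LINT x|circle_measure. cnj (cnj x) * F (cnj (cnj x)) * (cnj x) powi (- n))"
    by (rule integral_circle_cnj[symmetric]) measurable
  also have "\<dots> = (LINT x|circle_measure. F x * x powi (- (- n - 1)))"
  proof (rule integral_cong_AE)
    show "AE x in circle_measure. cnj (cnj x) * F (cnj (cnj x)) * (cnj x) powi (- n) = F x * x powi (- (- n - 1))"
      using AE_circle_cnj AE_circle_nonzero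
    proof eventually_elim
      case (elim x)
      have "(cnj x) powi (- n) = x powi n" using elim by (simp add: power_int_minus power_int_inverse)
      moreover have "x powi (- (- n - 1)) = x * x powi n"
        using elim power_int_add[of x 1 n] by (simp add: add.commute)
      ultimately show ?case by simp
    qed
  qed (simp_all add: borel_measurable_circle)
  finally show ?thesis using F by (simp add: fourier_coeff.abs_eq)
qed

text \<open>On the circle this is the function \<open>cnj (f (cnj z))\<close>.\<close>

definition sharp :: "circle_fun \<Rightarrow> circle_fun" where
  "sharp f = zpow (-1) * conj_fun (flip f)"

text \<open>The two index reversals, by the flip and by the conjugation, cancel, and the factor
  z^(-1) undoes the shift. All properties tied to frequencies are therefore preserved.\<close>

lemma fourier_coeff_sharp [simp]: "fourier_coeff (sharp f) n = cnj (fourier_coeff f n)"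
  unfolding sharp_def by (simp add: fourier_coeff_conj fourier_coeff_flip)

lemma sharp_L2: "f \<in> L2 \<Longrightarrow> sharp f \<in> L2"
  unfolding sharp_def by (intro L2_Linf_mult L2_conj flip_L2) auto

lemma sharp_Linf: "f \<in> Linf \<Longrightarrow> sharp f \<in> Linf"
  unfolding sharp_def by (intro Linf_mult Linf_conj flip_Linf) auto

lemma sharp_H2: "f \<in> H2 \<Longrightarrow> sharp f \<in> H2"
  by (auto simp: H2_def sharp_L2)

lemma sharp_sharp: "f \<in> L2 \<Longrightarrow> sharp (sharp f) = f"
  by (rule fourier_coeff_eqI) (auto intro: sharp_L2)

lemma sharp_mult: "sharp (f * g) = sharp f * sharp g"
  unfolding sharp_def flip_mult by (simp add: ac_simps)

lemma sharp_add: "sharp (f + g) = sharp f + sharp g"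
  unfolding sharp_def flip_add by (simp add: distrib_left)

lemma sharp_cscale: "sharp (cscale c f) = cscale (cnj c) (sharp f)"
  unfolding sharp_def flip_cscale by (simp add: cscale_mult_right)

lemma sharp_zpow [simp]: "sharp (zpow n) = zpow n"
  by (rule fourier_coeff_eqI) (auto intro: sharp_L2)

lemma sharp_1 [simp]: "sharp 1 = 1"
  using sharp_zpow[of 0] by simp

lemma sharp_polyf: "sharp (polyf p) = polyf (map_poly cnj p)"
proof (induction p)
  case 0
  show ?case using sharp_cscale[of 0 1] by simp
next
  case (pCons a p)
  then show ?case
    by (simp add: map_poly_pCons polyf_pCons sharp_add sharp_cscale sharp_mult)
qed

lemma poly_map_cnj: "poly (map_poly cnj p) z = cnj (poly p (cnj z))"
  by (induction p) (simp_all add: map_poly_pCons)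

text \<open>Conjugating the coefficients of q conjugates its zeros, which stay in the disc; the
  image of 1/q is identified by being an inverse of the conjugated polynomial.\<close>

lemma sharp_rational_funs: "r \<in> rational_funs \<Longrightarrow> sharp r \<in> rational_funs"
proof (elim rational_funsE)
  fix p q assume r: "r = polyf p * invf (polyf q)" and q: "q \<noteq> 0" "\<And>z. poly q z = 0 \<Longrightarrow> cmod z < 1"
    and nz: "\<And>z. cmod z = 1 \<Longrightarrow> poly q z \<noteq> 0"
  let ?q = "map_poly cnj q"
  have nz': "poly ?q z \<noteq> 0" if "cmod z = 1" for z using nz[of "cnj z"] that by (simp add: poly_map_cnj)
  have "polyf ?q * sharp (invf (polyf q)) = sharp (polyf q * invf (polyf q))"
    by (simp add: sharp_mult sharp_polyf)
  also have "polyf q * invf (polyf q) = 1" using nz by (rule polyf_invf)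
  finally have "invf (polyf ?q) * (polyf ?q * sharp (invf (polyf q))) = invf (polyf ?q)" by simp
  then have "sharp (invf (polyf q)) = invf (polyf ?q)" using nz' by simp
  then have "sharp r = polyf (map_poly cnj p) * invf (polyf ?q)" by (simp add: r sharp_mult sharp_polyf)
  also have "\<dots> \<in> rational_funs"
  proof (rule rational_funsI)
    show "?q \<noteq> 0" using q(1) by (simp add: map_poly_eq_0_iff)
    show "cmod z < 1" if "poly ?q z = 0" for z
      using q(2)[of "cnj z"] that by (simp add: poly_map_cnj)
  qed
  finally show ?thesis .
qed

lemma sharp_Hinf_plus_rational:
  assumes "f \<in> Hinf + rational_funs"
  shows "sharp f \<in> Hinf + rational_funs"
proof -
  obtain g r where "f = g + r" "g \<in> Hinf" "r \<in> rational_funs" using assms by (rule set_plus_elim)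
  then show ?thesis
    by (auto simp: sharp_add Hinf_def intro!: set_plus_intro sharp_Linf sharp_H2 sharp_rational_funs)
qed

section \<open>The conjugation of the model space\<close>

text \<open>The map is antilinear, so the preservation of subspaces and spans is proved directly,
  with conjugated scalars.\<close>

definition model_conj :: "circle_fun \<Rightarrow> circle_fun \<Rightarrow> circle_fun" where
  "model_conj \<theta> f = \<theta> * (zpow (-1) * conj_fun f)"

lemma model_conj_add: "model_conj \<theta> (f + g) = model_conj \<theta> f + model_conj \<theta> g"
  and model_conj_cscale: "model_conj \<theta> (cscale c f) = cscale (cnj c) (model_conj \<theta> f)"
  unfolding model_conj_def by (simp_all add: distrib_left cscale_mult_right)

lemma model_conj_subspace:
  assumes F: "circle_fun.subspace F"
  shows "circle_fun.subspace (model_conj \<theta> ` F)"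
proof (rule circle_fun.subspaceI)
  show "0 \<in> model_conj \<theta> ` F"
    using circle_fun.subspace_0[OF F] by (rule rev_image_eqI) (simp add: model_conj_def)
  fix x y c assume "x \<in> model_conj \<theta> ` F"
  then obtain u where u: "x = model_conj \<theta> u" "u \<in> F" by blast
  show "cscale c x \<in> model_conj \<theta> ` F"
    using circle_fun.subspace_scale[OF F u(2), of "cnj c"]
    by (rule rev_image_eqI) (simp add: u(1) model_conj_cscale)
  assume "y \<in> model_conj \<theta> ` F"
  then obtain v where v: "y = model_conj \<theta> v" "v \<in> F" by blast
  show "x + y \<in> model_conj \<theta> ` F"
    using circle_fun.subspace_add[OF F u(2) v(2)]
    by (rule rev_image_eqI) (simp add: u(1) v(1) model_conj_add)
qed

lemma model_conj_span:
  assumes "F \<subseteq> circle_fun.span B"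
  shows "model_conj \<theta> ` F \<subseteq> circle_fun.span (model_conj \<theta> ` B)"
proof -
  have "model_conj \<theta> f \<in> circle_fun.span (model_conj \<theta> ` B)" if "f \<in> circle_fun.span B" for f
    using that
  proof (induction rule: circle_fun.span_induct_alt)
    case base
    have "model_conj \<theta> 0 = 0" by (simp add: model_conj_def)
    then show ?case by (simp add: circle_fun.span_zero)
  next
    case (step c x y)
    then show ?case unfolding model_conj_add model_conj_cscale
      by (intro circle_fun.span_add circle_fun.span_scale) (auto intro: circle_fun.span_base)
  qed
  then show ?thesis using assms by auto
qed

context
  fixes \<theta> assumes inner: "inner_function \<theta>"
begin

lemma model_conj_involution: "model_conj \<theta> (model_conj \<theta> f) = f"
proof -
  have "model_conj \<theta> (model_conj \<theta> f) = (\<theta> * conj_fun \<theta>) * ((zpow (-1) * zpow 1) * f)"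
    unfolding model_conj_def by (simp add: ac_simps)
  then show ?thesis using inner by (simp add: inner_function_conj zpow_mult)
qed

lemma model_conj_theta: "model_conj \<theta> (\<theta> * v) = zpow (-1) * conj_fun v"
  using inner_function_conj(3)[OF inner] unfolding model_conj_def by (simp add: mult.left_commute)

lemma zpow_conj_H2: "v \<in> H2 \<Longrightarrow> zpow (-1) * conj_fun v \<in> below 0"
  using below_zpow_mult[OF conj_H2_below, of v "-1"] by simp

lemma zpow_conj_below: "u \<in> below 0 \<Longrightarrow> zpow (-1) * conj_fun u \<in> H2"
  using conj_below_H2[of "zpow 1 * u"] below_zpow_mult[of u 0 1] by simp

text \<open>Since conj(theta) k has only negative frequencies, the image conj(z conj(theta) k) is in
  \<open>H2\<close>. Its product with conj(theta) is conj(z k), which is orthogonal to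
  \<open>H2\<close>.\<close>

lemma model_conj_model_space:
  assumes k: "k \<in> model_space \<theta>"
  shows "model_conj \<theta> k \<in> model_space \<theta>"
proof -
  have "k = \<theta> * (conj_fun \<theta> * k)" using inner by (simp add: inner_function_conj)
  then have "model_conj \<theta> k = zpow (-1) * conj_fun (conj_fun \<theta> * k)" by (metis model_conj_theta)
  then have "model_conj \<theta> k \<in> H2"
    using zpow_conj_below[OF model_space_conj_below[OF inner k]] by simp
  moreover have "cinner (model_conj \<theta> k) (\<theta> * g) = 0" if "g \<in> H2" for g
    using H2_below_orthogonal(1)[OF zpow_conj_H2[OF model_space_H2[OF k]] that] inner
    by (simp add: model_conj_def cinner_mult_left inner_function_conj)
  ultimately show ?thesis by (auto simp: model_space_def)
qed

text \<open>The conjugation preserves the model space and exchanges the other two summands of the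
  splitting, \<open>below 0\<close> and theta \<open>H2\<close>.\<close>

lemma orth_proj_model_conj:
  assumes "f \<in> L2"
  shows "orth_proj (model_space \<theta>) (model_conj \<theta> f) = model_conj \<theta> (orth_proj (model_space \<theta>) f)"
proof -
  obtain k u v where f: "f = k + u + \<theta> * v" "k \<in> model_space \<theta>" "u \<in> below 0" "v \<in> H2"
    using model_decomp[OF inner assms] by blast
  have "model_conj \<theta> f = model_conj \<theta> k + zpow (-1) * conj_fun v + \<theta> * (zpow (-1) * conj_fun u)"
    unfolding f(1) model_conj_add model_conj_theta by (simp add: model_conj_def add_ac)
  then have "orth_proj (model_space \<theta>) (model_conj \<theta> f) = model_conj \<theta> k"
    using f inner by (simp add: orth_proj_model_eq model_conj_model_space zpow_conj_H2 zpow_conj_below)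
  then show ?thesis using f inner by (simp add: orth_proj_model_eq)
qed

text \<open>The inserted theta is cancelled inside the conjugation; it serves to express the flip
  through a map that commutes with the projection.\<close>

lemma flip_eq_model_conj: "flip h = model_conj \<theta> (\<theta> * sharp h)"
  unfolding model_conj_theta by (simp add: sharp_def zpow_mult flip: mult.assoc)

lemma hankel_eq_toeplitz:
  assumes "\<psi> \<in> Linf" "g \<in> H2"
  shows "orth_proj (model_space \<theta>) (flip (\<psi> * g))
    = model_conj \<theta> (orth_proj (model_space \<theta>) (\<theta> * sharp \<psi> * sharp g))"
proof -
  have "\<theta> * sharp (\<psi> * g) \<in> L2"
    by (intro theta_mult_L2(1)[OF inner] sharp_L2 L2_Linf_mult assms H2_L2)
  then show ?thesis
    unfolding flip_eq_model_conj by (simp add: orth_proj_model_conj sharp_mult mult.assoc)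
qed

text \<open>\<open>sharp\<close> maps \<open>H2\<close> onto itself, so the argument
  \<open>sharp g\<close> may be replaced by g when only the range matters.\<close>

lemma hankel_image:
  assumes "\<psi> \<in> Linf"
  shows "(\<lambda>g. orth_proj (model_space \<theta>) (flip (\<psi> * g))) ` H2
    = model_conj \<theta> ` (\<lambda>g. orth_proj (model_space \<theta>) (\<theta> * sharp \<psi> * g)) ` H2"
proof -
  have "sharp ` H2 = H2"
    using sharp_H2 sharp_sharp by (force simp: image_iff)
  then have "(\<lambda>g. orth_proj (model_space \<theta>) (\<theta> * sharp \<psi> * g)) ` H2
      = (\<lambda>g. orth_proj (model_space \<theta>) (\<theta> * sharp \<psi> * sharp g)) ` H2"
    by (metis image_image)
  then show ?thesis using assms by (simp add: image_image hankel_eq_toeplitz)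
qed

text \<open>For the symbol theta psi# the Toeplitz criterion tests conj(theta) theta psi# = psi#,
  and \<open>sharp\<close> is an involution on Hinf + R.\<close>

lemma hankel_finite_rank_iff:
  assumes psi: "\<psi> \<in> Linf"
  shows "(\<exists>B. finite B \<and> (\<lambda>g. orth_proj (model_space \<theta>) (flip (\<psi> * g))) ` H2 \<subseteq> circle_fun.span B)
    \<longleftrightarrow> \<psi> \<in> Hinf + rational_funs \<or> finite_blaschke \<theta>"
proof -
  let ?F = "(\<lambda>g. orth_proj (model_space \<theta>) (\<theta> * sharp \<psi> * g)) ` H2"
  have "\<theta> * sharp \<psi> \<in> Linf" using psi inner by (auto intro: Linf_mult sharp_Linf inner_function_Linf)
  note iff = finite_rank_iff[OF inner this]
  \<comment> \<open>The involution turns the one-sided span lemma into an equivalence.\<close>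
  have "?F = model_conj \<theta> ` model_conj \<theta> ` ?F" by (simp add: image_image model_conj_involution)
  then have "(\<exists>B. finite B \<and> model_conj \<theta> ` ?F \<subseteq> circle_fun.span B) \<longleftrightarrow> (\<exists>B. finite B \<and> ?F \<subseteq> circle_fun.span B)"
    using model_conj_span[of _ _ \<theta>] by (metis finite_imageI)
  moreover have "sharp \<psi> \<in> Hinf + rational_funs \<longleftrightarrow> \<psi> \<in> Hinf + rational_funs"
    using sharp_Hinf_plus_rational[of \<psi>] sharp_Hinf_plus_rational[of "sharp \<psi>"]
      sharp_sharp[OF Linf_imp_L2[OF psi]] by auto
  ultimately show ?thesis
    unfolding hankel_image[OF psi] using iff inner by (simp add: inner_function_conj)
qed

lemma hankel_subspace:
  assumes psi: "\<psi> \<in> Linf"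
  shows "circle_fun.subspace ((\<lambda>g. orth_proj (model_space \<theta>) (flip (\<psi> * g))) ` H2)"
  unfolding hankel_image[OF psi]
proof -
  let ?F = "(\<lambda>g. orth_proj (model_space \<theta>) (\<theta> * sharp \<psi> * g)) ` H2"
  have "\<theta> * sharp \<psi> \<in> Linf" using psi inner by (auto intro: Linf_mult sharp_Linf inner_function_Linf)
  then have "circle_fun.subspace ?F" by (rule toep_subspace[OF inner])
  then show "circle_fun.subspace (model_conj \<theta> ` ?F)" by (rule model_conj_subspace)
qed

end

theorem theorem2p6:
  fixes \<phi> \<eta> \<theta> :: circle_fun
  assumes "\<phi> \<in> Linf" and "inner_function \<eta>" and "inner_function \<theta>"
  shows "(finite_rank_on ((*) \<eta> ` H2) (toeplitz_op \<theta> \<phi>) \<longleftrightarrow>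
            \<phi> \<in> (*) (conj_fun \<eta> * \<theta>) ` (Hinf + rational_funs) \<or> finite_blaschke \<theta>)
       \<and> (finite_rank_on ((*) \<eta> ` H2) (hankel_op \<theta> \<phi>) \<longleftrightarrow>
            \<phi> \<in> (*) (conj_fun \<eta>) ` (Hinf + rational_funs) \<or> finite_blaschke \<theta>)"
proof -
  \<comment> \<open>Every h in eta \<open>H2\<close> is eta g with g in \<open>H2\<close>, and phi h
    = psi g; absorbing eta into the symbol reduces the domain to \<open>H2\<close>.\<close>
  define \<psi> where "\<psi> = \<phi> * \<eta>"
  have psi: "\<psi> \<in> Linf" unfolding \<psi>_def using assms by (auto intro: Linf_mult inner_function_Linf)
  note eta = inner_function_conj[OF assms(2)] and theta = inner_function_conj[OF assms(3)]
  have phi: "\<phi> = conj_fun \<eta> * \<psi>" unfolding \<psi>_def using eta(3)[of \<phi>] by (simp add: ac_simps)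
  \<comment> \<open>Multiplication by the unimodular function conj(eta) theta is invertible, so
    membership holds or fails on both sides whatever the set \<open>X\<close> is.\<close>
  have "\<phi> \<in> (*) (conj_fun \<eta> * \<theta>) ` X \<longleftrightarrow> conj_fun \<theta> * \<psi> \<in> X" for X
  proof
    assume "\<phi> \<in> (*) (conj_fun \<eta> * \<theta>) ` X"
    then obtain x where "x \<in> X" and x: "\<phi> = conj_fun \<eta> * \<theta> * x" by auto
    have "conj_fun \<theta> * \<psi> = (conj_fun \<eta> * \<eta>) * ((conj_fun \<theta> * \<theta>) * x)"
      unfolding \<psi>_def x by (simp only: ac_simps)
    then show "conj_fun \<theta> * \<psi> \<in> X" using eta theta \<open>x \<in> X\<close> by simp
  next
    assume "conj_fun \<theta> * \<psi> \<in> X"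
    moreover have "\<phi> = conj_fun \<eta> * \<theta> * (conj_fun \<theta> * \<psi>)" unfolding phi using theta by (simp add: mult.assoc)
    ultimately show "\<phi> \<in> (*) (conj_fun \<eta> * \<theta>) ` X" by blast
  qed
  moreover have "\<phi> \<in> (*) (conj_fun \<eta>) ` X \<longleftrightarrow> \<psi> \<in> X" for X
  proof
    assume "\<phi> \<in> (*) (conj_fun \<eta>) ` X"
    then obtain x where "x \<in> X" and x: "\<phi> = conj_fun \<eta> * x" by auto
    have "\<psi> = (conj_fun \<eta> * \<eta>) * x" unfolding \<psi>_def x by (simp only: ac_simps)
    then show "\<psi> \<in> X" using eta \<open>x \<in> X\<close> by simp
  qed (use phi in blast)
  moreover have T: "toeplitz_op \<theta> \<phi> ` (*) \<eta> ` H2 = (\<lambda>g. orth_proj (model_space \<theta>) (\<psi> * g)) ` H2"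
    by (simp add: image_image toeplitz_op_def \<psi>_def mult.assoc)
  moreover have H: "hankel_op \<theta> \<phi> ` (*) \<eta> ` H2 = (\<lambda>g. orth_proj (model_space \<theta>) (flip (\<psi> * g))) ` H2"
    by (simp add: image_image hankel_op_def \<psi>_def mult.assoc)
  moreover have "circle_fun.subspace (toeplitz_op \<theta> \<phi> ` (*) \<eta> ` H2)"
    unfolding T using assms(3) psi by (rule toep_subspace)
  moreover have "circle_fun.subspace (hankel_op \<theta> \<phi> ` (*) \<eta> ` H2)"
    unfolding H using assms(3) psi by (rule hankel_subspace)
  ultimately show ?thesis
    using finite_rank_iff[OF assms(3) psi] hankel_finite_rank_iff[OF assms(3) psi]
    by (simp add: finite_rank_on_iff)
qed

end
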